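(* Let $K$ and $L$ be simplicial complexes on disjoint vertex sets, with the vertices of the disjoint union $K\dot\cup L$ labelled so that $(K\dot{\cup}L)_{0}=[n]$, and let $S=\{ s_{1}<\dots<s_{j}<s_{j+1}\}\subseteq[n]$ (with $j\ge 1$). Then $$S\in\Delta(K\dot{\cup}L)\iff s_{j+1}-s_{j}\leq |I^{1}_{\mathrm{init}_{|S|-1}(S)}\cap\Delta(K)|+|I^{1}_{\mathrm{init}_{|S|-1}(S)}\cap\Delta(L)|.$$
   Context: Simplicial complexes are finite and contain the empty set. For a complex $K$, $K_0$ denotes its vertex set. $[n]=\{1,\dots,n\}$. $K\dot\cup L$ denotes the union of two complexes with disjoint vertex sets. Lexicographic order: for sets $S\ne T$ of positive integers of equal size, $S<_L T$ iff $\min(S\triangle T)\in S$. Algebraic shifting (exterior): let $K$ be a simplicial complex with vertex set contained in $[n]$ (label the vertices by positive integers if necessary). Let $V$ be a real vector space with basis $e_1,\dots,e_n$, and let $f_i=\sum_{j=1}^n\alpha_{ij}e_j$, $1\le i\le n$, where the $n^2$ real numbers $\alpha_{ij}$ are algebraically independent over $\mathbb{Q}$. For $S=\{s_1<\dots<s_k\}\subseteq[n]$ put $e_S=e_{s_1}\wedge\dots\wedge e_{s_k}$, $f_S=f_{s_1}\wedge\dots\wedge f_{s_k}$ in $\bigwedge V$, and let $\tilde f_S$ be the image of $f_S$ in $(\bigwedge V)/(e_T: T\subseteq[n],\,T\notin K)$. Then $$\Delta(K)=\{S\subseteq[n]:\ \tilde f_S\notin \mathrm{span}\{\tilde f_{S'}: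 |S'|=|S|,\ S'<_L S\}\}.$$ $\Delta(K)$ does not depend on the choice of the generic matrix, of $n$, or of the vertex labelling; it is a simplicial complex with vertex set $\{1,\dots,|K_0|\}$. For a finite set $T$ of positive integers, $\mathrm{init}_j(T)$ is the set of the $j$ smallest elements of $T$. For $S\subseteq[n]$, $I_S^1=\{T\subseteq[n]: |T|=|S|+1,\ \mathrm{init}_{|S|}(T)=S\}$. *)

theory Defs
  imports Complex_Main "HOL-Library.Poly_Mapping" "HOL-Library.Set_Algebras"
begin

section \<open>The exterior algebra\<close>

text \<open>
  The exterior algebra of the real vector space with basis e_1, e_2, ...: an element is the family
  of its coefficients with respect to the basis (e_S), where S ranges over the finite sets of
  indices. The wedge product is written as multiplication, so that the type becomes a unital
  associative real algebra and the library notions of span and of product of a list apply to it.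
  The exterior algebra of the span of e_1, ..., e_n is the subalgebra \<open>ext_alg n\<close> below.
\<close>

typedef exterior =
  "{f :: nat set \<Rightarrow> real. finite {S. f S \<noteq> 0} \<and> (\<forall>S. f S \<noteq> 0 \<longrightarrow> finite S)}"
  morphisms coeff Ext
  by (rule exI[of _ "\<lambda>_. 0"]) simp

setup_lifting type_definition_exterior

text \<open>For disjoint S and T, the wedge product of e_S and e_T is \<open>shuffle_sign S T\<close> times the basis
  element of the union, the exponent being the number of transpositions needed to sort.\<close>

definition shuffle_sign :: "nat set \<Rightarrow> nat set \<Rightarrow> real" where
  "shuffle_sign S T = (- 1) ^ card {(s, t). s \<in> S \<and> t \<in> T \<and> t < s}"

definition wedge_coeff :: "(nat set \<Rightarrow> real) \<Rightarrow> (nat set \<Rightarrow> real) \<Rightarrow> nat set \<Rightarrow> real" where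
  "wedge_coeff f g U = (\<Sum>S\<in>Pow U. shuffle_sign S (U - S) * f S * g (U - S))"

lemma shuffle_sign_empty [simp]: "shuffle_sign {} T = 1" "shuffle_sign S {} = 1"
  by (simp_all add: shuffle_sign_def)

lemma shuffle_sign_Un_left:
  assumes "finite A" "finite B" "finite C" "A \<inter> B = {}"
  shows "shuffle_sign (A \<union> B) C = shuffle_sign A C * shuffle_sign B C"
proof -
  have "{(s, t). s \<in> A \<union> B \<and> t \<in> C \<and> t < s} =
      {(s, t). s \<in> A \<and> t \<in> C \<and> t < s} \<union> {(s, t). s \<in> B \<and> t \<in> C \<and> t < s}"
    by auto
  moreover have "finite {(s, t). s \<in> A \<and> t \<in> C \<and> t < s}"
    by (rule finite_subset[of _ "A \<times> C"]) (use assms in auto)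
  moreover have "finite {(s, t). s \<in> B \<and> t \<in> C \<and> t < s}"
    by (rule finite_subset[of _ "B \<times> C"]) (use assms in auto)
  moreover have "{(s, t). s \<in> A \<and> t \<in> C \<and> t < s} \<inter> {(s, t). s \<in> B \<and> t \<in> C \<and> t < s} = {}"
    using assms by auto
  ultimately show ?thesis
    by (simp add: shuffle_sign_def card_Un_disjoint power_add)
qed

lemma shuffle_sign_Un_right:
  assumes "finite A" "finite B" "finite C" "B \<inter> C = {}"
  shows "shuffle_sign A (B \<union> C) = shuffle_sign A B * shuffle_sign A C"
proof -
  have "{(s, t). s \<in> A \<and> t \<in> B \<union> C \<and> t < s} =
      {(s, t). s \<in> A \<and> t \<in> B \<and> t < s} \<union> {(s, t). s \<in> A \<and> t \<in> C \<and> t < s}"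
    by auto
  moreover have "finite {(s, t). s \<in> A \<and> t \<in> B \<and> t < s}"
    by (rule finite_subset[of _ "A \<times> B"]) (use assms in auto)
  moreover have "finite {(s, t). s \<in> A \<and> t \<in> C \<and> t < s}"
    by (rule finite_subset[of _ "A \<times> C"]) (use assms in auto)
  moreover have "{(s, t). s \<in> A \<and> t \<in> B \<and> t < s} \<inter> {(s, t). s \<in> A \<and> t \<in> C \<and> t < s} = {}"
    using assms by auto
  ultimately show ?thesis
    by (simp add: shuffle_sign_def card_Un_disjoint power_add)
qed

lemma wedge_coeff_nonzeroE:
  assumes "wedge_coeff f g U \<noteq> 0"
  obtains S where "finite U" "S \<subseteq> U" "f S \<noteq> 0" "g (U - S) \<noteq> 0"
proof -
  have "finite (Pow U)"
    using assms unfolding wedge_coeff_def by (rule contrapos_np) (rule sum.infinite)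
  moreover obtain S where "S \<in> Pow U" "shuffle_sign S (U - S) * f S * g (U - S) \<noteq> 0"
    using assms unfolding wedge_coeff_def by (rule sum.not_neutral_contains_not_neutral)
  ultimately show ?thesis
    using that by auto
qed

lemma wedge_coeff_assoc:
  "wedge_coeff (wedge_coeff f g) h U = wedge_coeff f (wedge_coeff g h) U"
proof (cases "finite U")
  case False
  then have "infinite (Pow U)" by simp
  then show ?thesis by (simp add: wedge_coeff_def)
next
  case fin: True
  have fs: "finite S" if "S \<subseteq> U" for S
    using fin that finite_subset by blast
  let ?l = "\<lambda>(S, R). shuffle_sign S (U - S) *
              (shuffle_sign R (S - R) * f R * g (S - R)) * h (U - S)"
  let ?r = "\<lambda>(R, Q). shuffle_sign R (U - R) * f R *
              (shuffle_sign Q (U - R - Q) * g Q * h (U - R - Q))"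
  have "wedge_coeff (wedge_coeff f g) h U = sum ?l (SIGMA S:Pow U. Pow S)"
    unfolding wedge_coeff_def
    by (subst sum.Sigma[symmetric]) (use fs fin in \<open>auto simp: sum_distrib_left sum_distrib_right\<close>)
  also have "\<dots> = sum ?r (SIGMA R:Pow U. Pow (U - R))"
  proof (rule sum.reindex_bij_witness[where i = "\<lambda>(R, Q). (R \<union> Q, R)" and j = "\<lambda>(S, R). (R, S - R)"])
    fix x assume "x \<in> (SIGMA S:Pow U. Pow S)"
    then obtain S R where x: "x = (S, R)" and SR: "S \<subseteq> U" "R \<subseteq> S" by auto
    have [simp]: "U - R - (S - R) = U - S" using SR by auto
    have "shuffle_sign S (U - S) = shuffle_sign R (U - S) * shuffle_sign (S - R) (U - S)"
    proof -
      have "S = R \<union> (S - R)" using SR by auto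
      moreover have "finite R" "finite (S - R)" "finite (U - S)" using SR fs by auto
      moreover have "R \<inter> (S - R) = {}" by auto
      ultimately show ?thesis
        using shuffle_sign_Un_left[of R "S - R" "U - S"] by simp
    qed
    moreover have "shuffle_sign R (U - R) = shuffle_sign R (S - R) * shuffle_sign R (U - S)"
    proof -
      have "U - R = (S - R) \<union> (U - S)" using SR by auto
      moreover have "finite R" "finite (S - R)" "finite (U - S)" using SR fs by auto
      moreover have "(S - R) \<inter> (U - S) = {}" by auto
      ultimately show ?thesis
        using shuffle_sign_Un_right[of R "S - R" "U - S"] by simp
    qed
    ultimately show "?r ((\<lambda>(S, R). (R, S - R)) x) = ?l x"
      by (simp add: x)
  qed auto
  also have "\<dots> = wedge_coeff f (wedge_coeff g h) U"
    unfolding wedge_coeff_def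
    by (subst sum.Sigma[symmetric]) (use fin in \<open>auto simp: sum_distrib_left\<close>)
  finally show ?thesis .
qed

instantiation exterior :: real_algebra_1
begin

lift_definition zero_exterior :: exterior is "\<lambda>_. 0" by simp

lift_definition one_exterior :: exterior is "\<lambda>S. if S = {} then 1 else 0"
  by simp

lift_definition plus_exterior :: "exterior \<Rightarrow> exterior \<Rightarrow> exterior" is "\<lambda>f g S. f S + g S"
proof -
  fix f g :: "nat set \<Rightarrow> real"
  assume f: "finite {S. f S \<noteq> 0} \<and> (\<forall>S. f S \<noteq> 0 \<longrightarrow> finite S)"
    and g: "finite {S. g S \<noteq> 0} \<and> (\<forall>S. g S \<noteq> 0 \<longrightarrow> finite S)"
  have "finite {S. f S + g S \<noteq> 0}"
    by (rule finite_subset[of _ "{S. f S \<noteq> 0} \<union> {S. g S \<noteq> 0}"]) (use f g in auto)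
  moreover have "finite S" if "f S + g S \<noteq> 0" for S
    using f g that by (cases "f S = 0") auto
  ultimately show "finite {S. f S + g S \<noteq> 0} \<and> (\<forall>S. f S + g S \<noteq> 0 \<longrightarrow> finite S)"
    by blast
qed

lift_definition uminus_exterior :: "exterior \<Rightarrow> exterior" is "\<lambda>f S. - f S" by simp

definition minus_exterior :: "exterior \<Rightarrow> exterior \<Rightarrow> exterior" where
  "minus_exterior x y = x + - y"

lift_definition scaleR_exterior :: "real \<Rightarrow> exterior \<Rightarrow> exterior" is "\<lambda>c f S. c * f S"
proof -
  fix c :: real and f :: "nat set \<Rightarrow> real"
  assume f: "finite {S. f S \<noteq> 0} \<and> (\<forall>S. f S \<noteq> 0 \<longrightarrow> finite S)"
  have "finite {S. c * f S \<noteq> 0}"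
    by (rule finite_subset[of _ "{S. f S \<noteq> 0}"]) (use f in auto)
  moreover have "finite S" if "c * f S \<noteq> 0" for S
    using f that by (cases "f S = 0") auto
  ultimately show "finite {S. c * f S \<noteq> 0} \<and> (\<forall>S. c * f S \<noteq> 0 \<longrightarrow> finite S)"
    by blast
qed

lift_definition times_exterior :: "exterior \<Rightarrow> exterior \<Rightarrow> exterior" is wedge_coeff
proof -
  fix f g :: "nat set \<Rightarrow> real"
  assume f: "finite {S. f S \<noteq> 0} \<and> (\<forall>S. f S \<noteq> 0 \<longrightarrow> finite S)"
    and g: "finite {S. g S \<noteq> 0} \<and> (\<forall>S. g S \<noteq> 0 \<longrightarrow> finite S)"
  have "{U. wedge_coeff f g U \<noteq> 0} \<subseteq> (\<lambda>(S, T). S \<union> T) ` ({S. f S \<noteq> 0} \<times> {T. g T \<noteq> 0})"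
  proof
    fix U assume "U \<in> {U. wedge_coeff f g U \<noteq> 0}"
    then have "wedge_coeff f g U \<noteq> 0" by simp
    then obtain S where S: "S \<subseteq> U" "f S \<noteq> 0" "g (U - S) \<noteq> 0"
      by (rule wedge_coeff_nonzeroE)
    show "U \<in> (\<lambda>(S, T). S \<union> T) ` ({S. f S \<noteq> 0} \<times> {T. g T \<noteq> 0})"
      by (rule image_eqI[of _ _ "(S, U - S)"]) (use S in auto)
  qed
  then have "finite {U. wedge_coeff f g U \<noteq> 0}"
    by (rule finite_subset) (use f g in simp)
  moreover have "finite U" if "wedge_coeff f g U \<noteq> 0" for U
    using that by (rule wedge_coeff_nonzeroE)
  ultimately show "finite {U. wedge_coeff f g U \<noteq> 0} \<and> (\<forall>U. wedge_coeff f g U \<noteq> 0 \<longrightarrow> finite U)"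
    by blast
qed

instance
proof
  fix x y z :: exterior and c d :: real
  show "x + y + z = x + (y + z)" by transfer (simp add: add.assoc)
  show "x + y = y + x" by transfer (simp add: add.commute)
  show "0 + x = x" by transfer simp
  show "- x + x = 0" by transfer simp
  show "x - y = x + - y" by (rule minus_exterior_def)
  show "c *\<^sub>R (x + y) = c *\<^sub>R x + c *\<^sub>R y" by transfer (simp add: distrib_left)
  show "(c + d) *\<^sub>R x = c *\<^sub>R x + d *\<^sub>R x" by transfer (simp add: distrib_right)
  show "c *\<^sub>R d *\<^sub>R x = (c * d) *\<^sub>R x" by transfer (simp add: mult.assoc)
  show "1 *\<^sub>R x = x" by transfer simp
  show "x * y * z = x * (y * z)"
    by transfer (simp add: fun_eq_iff wedge_coeff_assoc)
  show "(x + y) * z = x * z + y * z"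
    by transfer (simp only: fun_eq_iff wedge_coeff_def distrib_left distrib_right sum.distrib simp_thms)
  show "x * (y + z) = x * y + x * z"
    by transfer (simp only: fun_eq_iff wedge_coeff_def distrib_left distrib_right sum.distrib simp_thms)
  show "c *\<^sub>R x * y = c *\<^sub>R (x * y)"
    by transfer (simp only: fun_eq_iff wedge_coeff_def sum_distrib_left mult_ac simp_thms)
  show "x * c *\<^sub>R y = c *\<^sub>R (x * y)"
    by transfer (simp only: fun_eq_iff wedge_coeff_def sum_distrib_left mult_ac simp_thms)
  show "1 * x = x"
  proof transfer
    fix f :: "nat set \<Rightarrow> real"
    assume f: "finite {S. f S \<noteq> 0} \<and> (\<forall>S. f S \<noteq> 0 \<longrightarrow> finite S)"
    have "wedge_coeff (\<lambda>S. if S = {} then 1 else 0) f U = f U" for U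
    proof (cases "finite U")
      case True
      have "wedge_coeff (\<lambda>S. if S = {} then 1 else 0) f U = (\<Sum>S\<in>Pow U. if S = {} then f U else 0)"
        unfolding wedge_coeff_def by (rule sum.cong) auto
      then show ?thesis using True by simp
    next
      case False
      then show ?thesis using f by (auto simp: wedge_coeff_def)
    qed
    then show "wedge_coeff (\<lambda>S. if S = {} then 1 else 0) f = f" by (rule ext)
  qed
  show "x * 1 = x"
  proof transfer
    fix f :: "nat set \<Rightarrow> real"
    assume f: "finite {S. f S \<noteq> 0} \<and> (\<forall>S. f S \<noteq> 0 \<longrightarrow> finite S)"
    have "wedge_coeff f (\<lambda>S. if S = {} then 1 else 0) U = f U" for U
    proof (cases "finite U")
      case True
      have "wedge_coeff f (\<lambda>S. if S = {} then 1 else 0) U = (\<Sum>S\<in>Pow U. if S = U then f U else 0)"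
        unfolding wedge_coeff_def by (rule sum.cong) auto
      then show ?thesis using True by simp
    next
      case False
      then show ?thesis using f by (auto simp: wedge_coeff_def)
    qed
    then show "wedge_coeff f (\<lambda>S. if S = {} then 1 else 0) = f" by (rule ext)
  qed
  show "(0 :: exterior) \<noteq> 1" by transfer (auto simp: fun_eq_iff)
qed

end

lift_definition ext_gen :: "nat \<Rightarrow> exterior" is "\<lambda>i S. if S = {i} then 1 else 0"
  by (auto split: if_splits)

definition wedge_of :: "(nat \<Rightarrow> exterior) \<Rightarrow> nat set \<Rightarrow> exterior" where
  "wedge_of v S = prod_list (map v (sorted_list_of_set S))"

abbreviation ext_basis :: "nat set \<Rightarrow> exterior" where
  "ext_basis \<equiv> wedge_of ext_gen"

definition ext_alg :: "nat \<Rightarrow> exterior set" where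
  "ext_alg n = span (ext_basis ` Pow {1..n})"

text \<open>Sanity checks of the multiplication: its defining relations, and the coefficients of an
  element are those with respect to the wedge products of generators.\<close>

lemma coeff_mult_gen:
  "coeff (ext_gen i * ext_gen j) U =
    (if i \<noteq> j \<and> U = {i, j} then (if i < j then 1 else - 1) else 0)"
proof (cases "finite U")
  case True
  have "coeff (ext_gen i * ext_gen j) U =
      (\<Sum>S\<in>Pow U. if S = {i} then shuffle_sign {i} (U - {i}) * (if U - {i} = {j} then 1 else 0) else 0)"
    by (simp add: times_exterior.rep_eq wedge_coeff_def ext_gen.rep_eq if_distrib cong: if_cong)
      (rule sum.cong, auto)
  also have "\<dots> = (if i \<in> U \<and> U - {i} = {j} then shuffle_sign {i} {j} else 0)"
    using True by (simp add: sum.delta)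
  also have "\<dots> = (if i \<noteq> j \<and> U = {i, j} then (if i < j then 1 else - 1) else 0)"
  proof -
    have "(i \<in> U \<and> U - {i} = {j}) = (i \<noteq> j \<and> U = {i, j})" by auto
    moreover have "{(s, t). s \<in> {i} \<and> t \<in> {j} \<and> t < s} = (if j < i then {(i, j)} else {})"
      by auto
    then have "shuffle_sign {i} {j} = (if j < i then - 1 else 1)"
      unfolding shuffle_sign_def by simp
    ultimately show ?thesis by auto
  qed
  finally show ?thesis .
qed (auto simp: times_exterior.rep_eq wedge_coeff_def)

lemma ext_gen_square: "ext_gen i * ext_gen i = 0"
  by (rule coeff_inject[THEN iffD1], rule ext) (simp add: coeff_mult_gen zero_exterior.rep_eq)

lemma ext_gen_anticommute: "ext_gen i * ext_gen j = - (ext_gen j * ext_gen i)"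
  by (rule coeff_inject[THEN iffD1], rule ext) (auto simp: coeff_mult_gen uminus_exterior.rep_eq)

lemma coeff_ext_basis:
  assumes "finite S"
  shows "coeff (ext_basis S) T = (if T = S then 1 else 0)"
  using assms
proof (induction "card S" arbitrary: S T)
  case 0
  then show ?case by (simp add: wedge_of_def one_exterior.rep_eq)
next
  case (Suc k)
  define m where "m = Min S"
  define R where "R = S - {m}"
  have ne: "S \<noteq> {}" using Suc by auto
  have m: "m \<in> S" "\<And>s. s \<in> S \<Longrightarrow> m \<le> s" using Suc ne by (auto simp: m_def)
  have R: "finite R" "card R = k" "m \<notin> R" "S = insert m R"
    using Suc m by (auto simp: R_def)
  have "sorted_list_of_set S = m # sorted_list_of_set R"
    unfolding m_def R_def using Suc ne by (simp add: sorted_list_of_set_nonempty)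
  then have S: "ext_basis S = ext_gen m * ext_basis R" by (simp add: wedge_of_def)
  have IH: "coeff (ext_basis R) T = (if T = R then 1 else 0)" for T
    using Suc(1)[of R] R by simp
  show ?case
  proof (cases "finite T")
    case True
    have "coeff (ext_basis S) T =
        (\<Sum>Q\<in>Pow T. if Q = {m} then shuffle_sign {m} (T - {m}) * (if T - {m} = R then 1 else 0) else 0)"
      unfolding S times_exterior.rep_eq wedge_coeff_def ext_gen.rep_eq IH
      by (rule sum.cong) auto
    also have "\<dots> = (if m \<in> T \<and> T - {m} = R then shuffle_sign {m} R else 0)"
      using True by (simp add: sum.delta)
    also have "shuffle_sign {m} R = 1"
    proof -
      have none: "{(s, t). s \<in> {m} \<and> t \<in> R \<and> t < s} = {}"
        using m R by fastforce
      show ?thesis unfolding shuffle_sign_def none by simp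
    qed
    also have "(m \<in> T \<and> T - {m} = R) = (T = S)" using R by auto
    finally show ?thesis .
  next
    case False
    then show ?thesis using Suc by (auto simp: S times_exterior.rep_eq wedge_coeff_def)
  qed
qed

section \<open>Algebraic independence over the rationals\<close>

text \<open>A polynomial over the rationals in variables of type \<open>'x\<close> is a finitely supported family of
  coefficients, indexed by the monomials \<open>'x \<Rightarrow>\<^sub>0 nat\<close>.\<close>

definition rat_poly_eval :: "(('x \<Rightarrow>\<^sub>0 nat) \<Rightarrow>\<^sub>0 rat) \<Rightarrow> ('x \<Rightarrow> real) \<Rightarrow> real" where
  "rat_poly_eval p a =
    (\<Sum>m\<in>Poly_Mapping.keys p. of_rat (Poly_Mapping.lookup p m) *
      (\<Prod>x\<in>Poly_Mapping.keys m. a x ^ Poly_Mapping.lookup m x))"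

definition alg_independent_over_rat :: "'x set \<Rightarrow> ('x \<Rightarrow> real) \<Rightarrow> bool" where
  "alg_independent_over_rat I a \<longleftrightarrow>
    (\<forall>p :: ('x \<Rightarrow>\<^sub>0 nat) \<Rightarrow>\<^sub>0 rat.
      (\<forall>m\<in>Poly_Mapping.keys p. Poly_Mapping.keys m \<subseteq> I) \<longrightarrow> rat_poly_eval p a = 0 \<longrightarrow> p = 0)"

definition generic_matrix :: "nat \<Rightarrow> (nat \<Rightarrow> nat \<Rightarrow> real) \<Rightarrow> bool" where
  "generic_matrix n \<alpha> \<longleftrightarrow> alg_independent_over_rat ({1..n} \<times> {1..n}) (\<lambda>(i, j). \<alpha> i j)"

section \<open>Simplicial complexes and algebraic shifting\<close>

definition abstract_simplicial_complex :: "'a set set \<Rightarrow> bool" where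
  "abstract_simplicial_complex K \<longleftrightarrow>
    finite K \<and> {} \<in> K \<and> (\<forall>S\<in>K. finite S) \<and> (\<forall>S\<in>K. \<forall>T. T \<subseteq> S \<longrightarrow> T \<in> K)"

definition vertices :: "'a set set \<Rightarrow> 'a set" where
  "vertices K = {v. {v} \<in> K}"

definition lex_less :: "nat set \<Rightarrow> nat set \<Rightarrow> bool" (infix "<\<^sub>L" 50) where
  "S <\<^sub>L T \<longleftrightarrow> S \<noteq> T \<and> card S = card T \<and> Min ((S - T) \<union> (T - S)) \<in> S"

definition generic_vec :: "nat \<Rightarrow> (nat \<Rightarrow> nat \<Rightarrow> real) \<Rightarrow> nat \<Rightarrow> exterior" where
  "generic_vec n \<alpha> i = (\<Sum>j=1..n. \<alpha> i j *\<^sub>R ext_gen j)"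

definition nonface_ideal :: "nat \<Rightarrow> nat set set \<Rightarrow> exterior set" where
  "nonface_ideal n K =
    span {x * ext_basis T * y | x T y. x \<in> ext_alg n \<and> y \<in> ext_alg n \<and> T \<subseteq> {1..n} \<and> T \<notin> K}"

text \<open>The quotient by the ideal is given by cosets \<open>x +o nonface_ideal n K\<close>; the span of a set of
  cosets is the image, under the quotient map, of the span of representatives.\<close>

definition algebraic_shifting :: "nat \<Rightarrow> (nat \<Rightarrow> nat \<Rightarrow> real) \<Rightarrow> nat set set \<Rightarrow> nat set set" where
  "algebraic_shifting n \<alpha> K =
    (let f = wedge_of (generic_vec n \<alpha>);
         quot = (\<lambda>x. x +o nonface_ideal n K)
     in {S. S \<subseteq> {1..n} \<and>
            quot (f S) \<notin> quot ` span {f S' | S'. S' \<subseteq> {1..n} \<and> card S' = card S \<and> S' <\<^sub>L S}})"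

text \<open>The matrix and the size used to shift a complex may be chosen freely subject to this
  condition; the shifted complex does not depend on them.\<close>

definition admissible :: "nat \<Rightarrow> (nat \<Rightarrow> nat \<Rightarrow> real) \<Rightarrow> nat set set \<Rightarrow> bool" where
  "admissible n \<alpha> K \<longleftrightarrow> vertices K \<subseteq> {1..n} \<and> generic_matrix n \<alpha>"

definition init :: "nat \<Rightarrow> nat set \<Rightarrow> nat set" where
  "init j T = set (take j (sorted_list_of_set T))"

definition one_extensions :: "nat \<Rightarrow> nat set \<Rightarrow> nat set set" where
  "one_extensions n S = {T. T \<subseteq> {1..n} \<and> card T = card S + 1 \<and> init (card S) T = S}"

end

theory Submission
  imports Defs
begin

text \<open>
  Fix \<open>A = init\<^sub>j(S)\<close> and let \<open>W\<^sub><\<close> and \<open>W\<^sub>\<le>\<close> be the spans, in the exterior face ring, of the \<open>f\<^sub>T\<close>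
  with \<open>|T| = j + 1\<close> for which \<open>T\<close> contains some \<open>j\<close>-set \<open>R <\<^sub>L A\<close>, respectively \<open>R \<le>\<^sub>L A\<close>. The sets
  \<open>T\<close> in question form initial segments of the lexicographic order whose difference consists of the
  sets \<open>A \<union> {t}\<close> with \<open>t > max A\<close>, so \<open>dim W\<^sub>\<le> - dim W\<^sub><\<close> counts the sets \<open>A \<union> {t}\<close> in the shifted
  complex. The same spaces are spanned by the products \<open>f\<^sub>R \<and> e\<^sub>c\<close>, and for a disjoint union each
  vertex \<open>c\<close> sees only one of the two complexes; hence both dimensions, and the count, are additive.
  Shiftedness turns the count into the inequality. That the matrices used for \<open>K\<close>, \<open>L\<close> and their
  union may differ rests on one principle: a matrix of rational polynomials has at a generic point
  a rank at least as large as at any other point.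
\<close>

section \<open>Linear algebra\<close>

text \<open>The shifted complex is a lexicographically greedy basis, and a greedy choice has no
  evident splitting over a disjoint union. What splits is a sum of spaces formed by multiplying
  fixed \<open>f_R\<close> with all of \<open>V\<close>, because there the last factor may run
  through any basis of \<open>V\<close>, in particular the \<open>e_c\<close>. The span up to a
  single set \<open>A \<union> {t}\<close> is not of this form, since \<open>t\<close> would run
  through only part of the rows. Additivity therefore reaches only the total number of tops over
  \<open>A\<close>, and closedness under lowering \<open>t\<close> is what recovers the individual
  sets from that number. A second obstacle is that \<open>K\<close> and \<open>L\<close> use only
  part of the columns of the matrix of the union, while the matrices of the statement have unrelated
  sizes. The matrix of the union is admissible for both parts, so additivity is proved for one
  common matrix and the change of matrices is postponed to the end. That change rests on the fact
  that shifted sets involve only as many rows as the complex has vertices.\<close>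

lemma dim_span_mono:
  fixes A B :: "'a::real_vector set"
  assumes "A \<subseteq> span B" "finite B"
  shows "dim A \<le> dim B"
proof -
  obtain C where C: "C \<subseteq> B" "B \<subseteq> span C" "card C = dim B"
    using basis_exists[of B] by metis
  have "A \<subseteq> span C"
    using assms(1) span_mono[OF C(2)] by (auto simp: span_span)
  then show ?thesis
    using dim_le_card[of A C] C assms(2) finite_subset by metis
qed

text \<open>Finiteness keeps \<open>dim\<close> meaningful: it is the cardinality of a basis, hence
  0 for an infinite one. An element of \<open>B\<close> outside \<open>span A\<close> would enlarge
  a basis of \<open>A\<close> to an independent set with more than \<open>dim B\<close>
  elements.\<close>

lemma span_eq_if_dim_ge:
  fixes A B :: "'a::real_vector set"
  assumes "A \<subseteq> span B" "finite A" "finite B" "dim B \<le> dim A"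
  shows "span A = span B"
proof -
  obtain C where C: "C \<subseteq> A" "independent C" "A \<subseteq> span C" "card C = dim A"
    using basis_exists[of A] by metis
  obtain D where D: "D \<subseteq> B" "independent D" "B \<subseteq> span D" "card D = dim B"
    using basis_exists[of B] by metis
  have fin: "finite C" "finite D" using C D assms by (auto intro: finite_subset)
  have "A \<subseteq> span D"
    using assms(1) span_mono[OF D(3)] by (auto simp: span_span)
  have "B \<subseteq> span C"
  proof
    fix x assume "x \<in> B"
    show "x \<in> span C"
    proof (rule ccontr)
      assume nx: "x \<notin> span C"
      then have "independent (insert x C)"
        using C by (simp add: independent_insertI)
      moreover have "insert x C \<subseteq> span D"
        using \<open>x \<in> B\<close> D C \<open>A \<subseteq> span D\<close> by auto
      ultimately have "card (insert x C) \<le> card D"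
        using independent_span_bound fin by blast
      moreover have "x \<notin> C" using nx span_base by blast
      ultimately show False using fin C D assms by simp
    qed
  qed
  then have "B \<subseteq> span A" using C(1) span_mono by blast
  then show ?thesis
    using assms(1) by (simp add: span_eq)
qed

lemma mem_span_iff_dim_insert:
  fixes A :: "'a::real_vector set"
  assumes "finite A"
  shows "x \<in> span A \<longleftrightarrow> dim (insert x A) = dim A"
proof
  assume "x \<in> span A"
  then have "span (insert x A) = span A" by (simp add: span_redundant)
  then show "dim (insert x A) = dim A" by (rule span_eq_dim)
next
  assume "dim (insert x A) = dim A"
  then have "span A = span (insert x A)"
    using assms by (intro span_eq_if_dim_ge) (auto intro: span_base)
  then show "x \<in> span A" by (simp add: span_base)
qed

text \<open>Applying \<open>P\<close> to a linear relation isolates its part in \<open>A\<close>, so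
  the relation splits, and the bases of the two sets together stay independent. The intended
  \<open>P\<close> is the coordinate projection onto the faces of one complex.\<close>

lemma dim_Un_projections:
  fixes A B :: "'a::real_vector set"
  assumes lin: "linear P" and A: "\<And>x. x \<in> A \<Longrightarrow> P x = x" and B: "\<And>x. x \<in> B \<Longrightarrow> P x = 0"
    and fin: "finite A" "finite B"
  shows "dim (A \<union> B) = dim A + dim B"
proof -
  obtain C where C: "C \<subseteq> A" "independent C" "A \<subseteq> span C" "card C = dim A"
    using basis_exists[of A] by metis
  obtain D where D: "D \<subseteq> B" "independent D" "B \<subseteq> span D" "card D = dim B"
    using basis_exists[of B] by metis
  have fins: "finite C" "finite D" using C D fin by (auto intro: finite_subset)
  have disj: "C \<inter> D = {}"
  proof (rule ccontr)
    assume "C \<inter> D \<noteq> {}"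
    then obtain x where "x \<in> C" "x \<in> D" by auto
    then have "x = 0" using A[of x] B[of x] C(1) D(1) by (metis subsetD)
    then show False using \<open>x \<in> C\<close> C(2) dependent_zero by blast
  qed
  have "independent (C \<union> D)"
  proof (rule independent_if_scalars_zero)
    show "finite (C \<union> D)" using fins by simp
    fix u x assume "(\<Sum>v\<in>C \<union> D. u v *\<^sub>R v) = 0" and x: "x \<in> C \<union> D"
    then have sum0: "(\<Sum>v\<in>C. u v *\<^sub>R v) + (\<Sum>v\<in>D. u v *\<^sub>R v) = 0"
      using fins disj by (simp add: sum.union_disjoint)
    then have "P ((\<Sum>v\<in>C. u v *\<^sub>R v) + (\<Sum>v\<in>D. u v *\<^sub>R v)) = 0"
      using lin by (simp add: linear_0)
    moreover have "P (\<Sum>v\<in>C. u v *\<^sub>R v) = (\<Sum>v\<in>C. u v *\<^sub>R v)"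
      using A C(1) by (auto simp: linear_sum[OF lin] linear_scale[OF lin] intro!: sum.cong)
    moreover have "P (\<Sum>v\<in>D. u v *\<^sub>R v) = 0"
      using B D(1) by (auto simp: linear_sum[OF lin] linear_scale[OF lin] intro!: sum.neutral)
    ultimately have C0: "(\<Sum>v\<in>C. u v *\<^sub>R v) = 0"
      by (simp add: linear_add[OF lin])
    then have D0: "(\<Sum>v\<in>D. u v *\<^sub>R v) = 0" using sum0 by simp
    show "u x = 0"
      using x C0 D0 independentD[OF C(2) fins(1) subset_refl C0] independentD[OF D(2) fins(2) subset_refl D0]
      by auto
  qed
  moreover have "A \<union> B \<subseteq> span (C \<union> D)"
    using C(3) D(3) span_mono[of C "C \<union> D"] span_mono[of D "C \<union> D"] by blast
  ultimately have "dim (A \<union> B) = card (C \<union> D)"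
    using C(1) D(1) by (intro dim_unique[of "C \<union> D"]) auto
  then show ?thesis using fins disj C D by (simp add: card_Un_disjoint)
qed

text \<open>The induction removes the largest index. It lies above all others, so its removal does
  not change the test for any smaller index, and its own test decides whether its vector joins the
  basis.\<close>

lemma greedy_basis:
  fixes g :: "'i \<Rightarrow> 'a::real_vector"
  assumes "finite J" and trans: "transp_on J r" and asym: "asymp_on J r"
    and total: "totalp_on J r"
  defines "G \<equiv> {i \<in> J. g i \<notin> span (g ` {k \<in> J. r k i})}"
  shows "inj_on g G" "independent (g ` G)" "span (g ` G) = span (g ` J)"
proof -
  have "inj_on g {i \<in> J. g i \<notin> span (g ` {k \<in> J. r k i})} \<and>
     independent (g ` {i \<in> J. g i \<notin> span (g ` {k \<in> J. r k i})}) \<and>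
     span (g ` {i \<in> J. g i \<notin> span (g ` {k \<in> J. r k i})}) = span (g ` J)"
    using assms(1-4)
  proof (induction "card J" arbitrary: J)
    case 0
    then show ?case by (simp add: independent_empty)
  next
    case (Suc n)
    then have "J \<noteq> {}" by auto
    then obtain i where i: "i \<in> J" "\<And>k. k \<in> J \<Longrightarrow> k \<noteq> i \<Longrightarrow> \<not> r i k"
      using Finite_Set.bex_max_element[of J r] Suc.prems by blast
    define J' where "J' = J - {i}"
    have J: "J = insert i J'" "i \<notin> J'" using i by (auto simp: J'_def)
    have below: "{k \<in> J. r k i} = J'"
    proof
      show "{k \<in> J. r k i} \<subseteq> J'"
        using i(1) asymp_onD[OF Suc.prems(3), of i i] by (auto simp: J'_def)
      show "J' \<subseteq> {k \<in> J. r k i}"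
        using i totalp_onD[OF Suc.prems(4)] by (auto simp: J'_def)
    qed
    have below': "{k \<in> J. r k l} = {k \<in> J'. r k l}" if "l \<in> J'" for l
      using i that J by auto
    define G' where "G' = {l \<in> J'. g l \<notin> span (g ` {k \<in> J'. r k l})}"
    have "n = card J'" "finite J'" using Suc J by auto
    moreover have "transp_on J' r" "asymp_on J' r" "totalp_on J' r"
      using Suc.prems J'_def
      by (auto intro: transp_on_subset asymp_on_subset totalp_on_subset)
    ultimately have IH: "inj_on g G'" "independent (g ` G')" "span (g ` G') = span (g ` J')"
      unfolding G'_def using Suc.hyps(1)[of J'] by auto
    have G: "{l \<in> J. g l \<notin> span (g ` {k \<in> J. r k l})} =
        (if g i \<in> span (g ` J') then G' else insert i G')"
      using below below' J(1) i(1) unfolding G'_def by auto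
    show ?case
    proof (cases "g i \<in> span (g ` J')")
      case True
      then have "span (g ` J) = span (g ` J')" using J by (simp add: span_redundant)
      then show ?thesis using True IH unfolding G by simp
    next
      case False
      then have ni: "g i \<notin> span (g ` G')" using IH by simp
      then have "g i \<notin> g ` G'" using span_base by blast
      moreover have "span (insert (g i) (g ` G')) = span (insert (g i) (g ` J'))"
        using IH(3) by (simp add: span_insert)
      moreover have "i \<notin> G'" using J by (auto simp: G'_def)
      ultimately show ?thesis
        using False IH ni J(1) unfolding G by (auto simp: independent_insertI)
    qed
  qed
  then show "inj_on g G" "independent (g ` G)" "span (g ` G) = span (g ` J)"
    unfolding G_def by blast+
qed

lemma dim_eq_card_greedy:
  fixes g :: "'i \<Rightarrow> 'a::real_vector"
  assumes "finite J" "transp_on J r" "asymp_on J r" "totalp_on J r"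
  shows "dim (g ` J) = card {i \<in> J. g i \<notin> span (g ` {k \<in> J. r k i})}"
proof -
  have "dim (g ` J) = card (g ` {i \<in> J. g i \<notin> span (g ` {k \<in> J. r k i})})"
    by (rule dim_eq_card[OF greedy_basis(3,2)[OF assms]])
  then show ?thesis
    by (simp add: card_image[OF greedy_basis(1)[OF assms]])
qed

section \<open>Generic rank\<close>

text \<open>Closure rules let the coefficients of wedge products be recognised by introduction
  rules; the translation into \<open>Poly_Mapping\<close> happens once, in
  \<open>polyfun_rat_poly_eval\<close>. Constants are rational because algebraic independence speaks
  of rational polynomials.\<close>

inductive_set polyfun :: "'x set \<Rightarrow> (('x \<Rightarrow> real) \<Rightarrow> real) set" for I where
  const: "(\<lambda>_. of_rat c) \<in> polyfun I"
| var: "x \<in> I \<Longrightarrow> (\<lambda>a. a x) \<in> polyfun I"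
| add: "f \<in> polyfun I \<Longrightarrow> g \<in> polyfun I \<Longrightarrow> (\<lambda>a. f a + g a) \<in> polyfun I"
| mult: "f \<in> polyfun I \<Longrightarrow> g \<in> polyfun I \<Longrightarrow> (\<lambda>a. f a * g a) \<in> polyfun I"

lemma polyfun_0: "(\<lambda>_. 0) \<in> polyfun I"
  using polyfun.const[of 0 I] by simp

lemma polyfun_1: "(\<lambda>_. 1) \<in> polyfun I"
  using polyfun.const[of 1 I] by simp

lemma polyfun_uminus: "f \<in> polyfun I \<Longrightarrow> (\<lambda>a. - f a) \<in> polyfun I"
  using polyfun.mult[OF polyfun.const[of "-1" I]] by fastforce

lemma polyfun_diff: "f \<in> polyfun I \<Longrightarrow> g \<in> polyfun I \<Longrightarrow> (\<lambda>a. f a - g a) \<in> polyfun I"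
  using polyfun.add[OF _ polyfun_uminus, of f I g] by simp

lemma polyfun_sum:
  "(\<And>i. i \<in> A \<Longrightarrow> f i \<in> polyfun I) \<Longrightarrow> (\<lambda>a. \<Sum>i\<in>A. f i a) \<in> polyfun I"
  by (induction A rule: infinite_finite_induct) (simp_all add: polyfun_0 polyfun.add)

definition monom_eval :: "('x \<Rightarrow>\<^sub>0 nat) \<Rightarrow> ('x \<Rightarrow> real) \<Rightarrow> real" where
  "monom_eval m a = (\<Prod>x\<in>Poly_Mapping.keys m. a x ^ Poly_Mapping.lookup m x)"

lemma monom_eval_superset:
  assumes "finite X" "Poly_Mapping.keys m \<subseteq> X"
  shows "monom_eval m a = (\<Prod>x\<in>X. a x ^ Poly_Mapping.lookup m x)"
  unfolding monom_eval_def using assms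
  by (intro prod.mono_neutral_left) (auto simp: in_keys_iff)

lemma monom_eval_add: "monom_eval (m + m') a = monom_eval m a * monom_eval m' a"
proof -
  let ?X = "Poly_Mapping.keys m \<union> Poly_Mapping.keys m'"
  have "monom_eval (m + m') a = (\<Prod>x\<in>?X. a x ^ Poly_Mapping.lookup (m + m') x)"
    by (rule monom_eval_superset) (simp_all add: keys_add)
  also have "\<dots> = (\<Prod>x\<in>?X. a x ^ Poly_Mapping.lookup m x) * (\<Prod>x\<in>?X. a x ^ Poly_Mapping.lookup m' x)"
    by (simp add: lookup_add power_add prod.distrib)
  also have "\<dots> = monom_eval m a * monom_eval m' a"
    by (subst (1 2) monom_eval_superset[of ?X]) auto
  finally show ?thesis .
qed

lemma rat_poly_eval_superset:
  assumes "finite M" "Poly_Mapping.keys p \<subseteq> M"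
  shows "rat_poly_eval p a = (\<Sum>m\<in>M. of_rat (Poly_Mapping.lookup p m) * monom_eval m a)"
  unfolding rat_poly_eval_def monom_eval_def[symmetric] using assms
  by (intro sum.mono_neutral_left) (auto simp: in_keys_iff)

lemma rat_poly_eval_0: "rat_poly_eval 0 a = 0"
  by (simp add: rat_poly_eval_def)

lemma rat_poly_eval_add: "rat_poly_eval (p + q) a = rat_poly_eval p a + rat_poly_eval q a"
proof -
  let ?M = "Poly_Mapping.keys p \<union> Poly_Mapping.keys q"
  have "rat_poly_eval (p + q) a =
      (\<Sum>m\<in>?M. of_rat (Poly_Mapping.lookup (p + q) m) * monom_eval m a)"
    by (rule rat_poly_eval_superset) (simp_all add: keys_add)
  also have "\<dots> = rat_poly_eval p a + rat_poly_eval q a"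
    by (subst (1 2) rat_poly_eval_superset[of ?M])
      (auto simp: lookup_add of_rat_add distrib_right sum.distrib)
  finally show ?thesis .
qed

lemma rat_poly_eval_sum: "rat_poly_eval (\<Sum>i\<in>A. p i) a = (\<Sum>i\<in>A. rat_poly_eval (p i) a)"
  by (induction A rule: infinite_finite_induct) (simp_all add: rat_poly_eval_0 rat_poly_eval_add)

lemma rat_poly_eval_single: "rat_poly_eval (Poly_Mapping.single m c) a = of_rat c * monom_eval m a"
  by (subst rat_poly_eval_superset[of "{m}"]) auto

lemma sum_single_keys: "p = (\<Sum>m\<in>Poly_Mapping.keys p. Poly_Mapping.single m (Poly_Mapping.lookup p m))"
proof (rule poly_mapping_eqI)
  fix k
  show "Poly_Mapping.lookup p k = Poly_Mapping.lookup
      (\<Sum>m\<in>Poly_Mapping.keys p. Poly_Mapping.single m (Poly_Mapping.lookup p m)) k"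
    by (cases "k \<in> Poly_Mapping.keys p")
      (auto simp: lookup_sum lookup_single when_def in_keys_iff sum.delta)
qed

lemma rat_poly_eval_mult: "rat_poly_eval (p * q) a = rat_poly_eval p a * rat_poly_eval q a"
proof -
  have "p * q = (\<Sum>m\<in>Poly_Mapping.keys p. \<Sum>k\<in>Poly_Mapping.keys q.
      Poly_Mapping.single (m + k) (Poly_Mapping.lookup p m * Poly_Mapping.lookup q k))"
    by (subst sum_single_keys[of p], subst sum_single_keys[of q])
      (simp add: sum_product mult_single)
  then show ?thesis
    by (simp add: rat_poly_eval_sum rat_poly_eval_single of_rat_mult monom_eval_add)
      (simp add: rat_poly_eval_def monom_eval_def sum_product mult_ac)
qed

lemma polyfun_rat_poly_eval:
  assumes "f \<in> polyfun I"
  obtains p where "\<And>m. m \<in> Poly_Mapping.keys p \<Longrightarrow> Poly_Mapping.keys m \<subseteq> I"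
    "\<And>a. f a = rat_poly_eval p a"
proof -
  have "\<exists>p. (\<forall>m\<in>Poly_Mapping.keys p. Poly_Mapping.keys m \<subseteq> I) \<and> (\<forall>a. f a = rat_poly_eval p a)"
    using assms
  proof induction
    case (const c)
    show ?case
      by (rule exI[of _ "Poly_Mapping.single 0 c"])
        (auto simp: rat_poly_eval_single monom_eval_def)
  next
    case (var x)
    then show ?case
      by (intro exI[of _ "Poly_Mapping.single (Poly_Mapping.single x 1) 1"])
        (auto simp: rat_poly_eval_single monom_eval_def)
  next
    case (add f g)
    then obtain p q where "\<forall>m\<in>Poly_Mapping.keys p. Poly_Mapping.keys m \<subseteq> I"
      "\<forall>a. f a = rat_poly_eval p a" "\<forall>m\<in>Poly_Mapping.keys q. Poly_Mapping.keys m \<subseteq> I"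
      "\<forall>a. g a = rat_poly_eval q a" by blast
    moreover from this have "Poly_Mapping.keys m \<subseteq> I" if "m \<in> Poly_Mapping.keys (p + q)" for m
      using keys_add[of p q] that by blast
    ultimately show ?case
      by (intro exI[of _ "p + q"]) (simp add: rat_poly_eval_add)
  next
    case (mult f g)
    then obtain p q where pq: "\<forall>m\<in>Poly_Mapping.keys p. Poly_Mapping.keys m \<subseteq> I"
      "\<forall>a. f a = rat_poly_eval p a" "\<forall>m\<in>Poly_Mapping.keys q. Poly_Mapping.keys m \<subseteq> I"
      "\<forall>a. g a = rat_poly_eval q a" by blast
    have "Poly_Mapping.keys m \<subseteq> I" if "m \<in> Poly_Mapping.keys (p * q)" for m
    proof -
      have "m \<in> {k + l |k l. k \<in> Poly_Mapping.keys p \<and> l \<in> Poly_Mapping.keys q}"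
        using that keys_mult by (rule subsetD[rotated])
      then obtain k l where "m = k + l" "k \<in> Poly_Mapping.keys p" "l \<in> Poly_Mapping.keys q"
        by blast
      then show ?thesis using pq keys_add[of k l] by blast
    qed
    then show ?case
      using pq by (intro exI[of _ "p * q"]) (simp add: rat_poly_eval_mult)
  qed
  then show ?thesis using that by blast
qed

text \<open>A zero at an algebraically independent point forces the representing polynomial to be 0,
  and then the function vanishes at every point.\<close>

lemma polyfun_generic_nonzero:
  assumes "alg_independent_over_rat I a" "f \<in> polyfun I" "f b \<noteq> 0"
  shows "f a \<noteq> 0"
proof
  assume "f a = 0"
  obtain p where p: "\<And>m. m \<in> Poly_Mapping.keys p \<Longrightarrow> Poly_Mapping.keys m \<subseteq> I"
    "\<And>a. f a = rat_poly_eval p a"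
    using polyfun_rat_poly_eval[OF assms(2)] by blast
  then have "p = 0"
    using assms(1) \<open>f a = 0\<close> unfolding alg_independent_over_rat_def by metis
  then show False using p(2)[of b] assms(3) by (simp add: rat_poly_eval_0)
qed

text \<open>One step of fraction-free Gaussian elimination with a pivot that is nonzero at \<open>b\<close>, and
  therefore nonzero at the generic point \<open>a\<close>.\<close>

lemma generic_rows_independent:
  assumes gen: "alg_independent_over_rat I a" and fin: "finite J"
    and poly: "\<And>i t. i \<in> J \<Longrightarrow> G i t \<in> polyfun I"
    and ind: "\<And>c. (\<And>t. (\<Sum>i\<in>J. c i * G i t b) = 0) \<Longrightarrow> \<forall>i\<in>J. c i = 0"
    and zero: "\<And>t. (\<Sum>i\<in>J. c i * G i t a) = 0"
  shows "\<forall>i\<in>J. c i = 0"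
  using fin poly ind zero
proof (induction J arbitrary: G c rule: finite_induct)
  case empty
  then show ?case by simp
next
  case (insert k J)
  have "\<exists>u. G k u b \<noteq> 0"
  proof (rule ccontr)
    assume "\<nexists>u. G k u b \<noteq> 0"
    then have "(\<Sum>i\<in>insert k J. (if i = k then 1 else 0) * G i t b) = 0" for t
      by (intro sum.neutral) auto
    then have "\<forall>i\<in>insert k J. (if i = k then 1 else 0 :: real) = 0"
      by (rule insert.prems(2))
    then show False by simp
  qed
  then obtain u where u: "G k u b \<noteq> 0" by blast
  define H where "H i t a = G k u a * G i t a - G i u a * G k t a" for i t a
  have Hpoly: "H i t \<in> polyfun I" if "i \<in> J" for i t
    unfolding H_def[abs_def] using that insert.prems(1)
    by (auto intro!: polyfun_diff polyfun.mult)
  \<comment> \<open>Every combination of the reduced rows is one of the original rows, with the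
    coefficient of row \<open>k\<close> chosen so that column \<open>u\<close> cancels. Row
    independence at \<open>b\<close> thus passes to \<open>H\<close>.\<close>
  have expand: "(\<Sum>i\<in>J. d i * H i t x) =
      (\<Sum>i\<in>insert k J. (if i = k then - (\<Sum>l\<in>J. d l * G l u x) else d i * G k u x) * G i t x)" for d t x
  proof -
    have "(\<Sum>i\<in>J. (if i = k then - (\<Sum>l\<in>J. d l * G l u x) else d i * G k u x) * G i t x) =
        (\<Sum>i\<in>J. d i * G k u x * G i t x)"
      using insert.hyps by (intro sum.cong) auto
    then show ?thesis using insert.hyps unfolding H_def
      by (simp add: algebra_simps sum_subtractf sum_distrib_left)
  qed
  have Hind: "\<forall>i\<in>J. d i = 0" if "\<And>t. (\<Sum>i\<in>J. d i * H i t b) = 0" for d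
  proof -
    have "\<forall>i\<in>insert k J. (if i = k then - (\<Sum>l\<in>J. d l * G l u b) else d i * G k u b) = 0"
      by (rule insert.prems(2)) (use that expand in simp)
    then show ?thesis using u insert.hyps by (auto split: if_splits)
  qed
  have "G k u a \<noteq> 0"
    using polyfun_generic_nonzero[OF gen] insert.prems(1) u by blast
  have "(\<Sum>i\<in>J. c i * H i t a) = 0" for t
  proof -
    have *: "c k * G k t a + (\<Sum>i\<in>J. c i * G i t a) = 0" for t
      using insert.prems(3)[of t] insert.hyps by simp
    have "(\<Sum>i\<in>J. c i * H i t a) =
        G k u a * (\<Sum>i\<in>J. c i * G i t a) - G k t a * (\<Sum>i\<in>J. c i * G i u a)"
      unfolding H_def by (simp add: algebra_simps sum_subtractf sum_distrib_left)
    also have "\<dots> = G k u a * (- c k * G k t a) - G k t a * (- c k * G k u a)"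
      using *[of t] *[of u] by (simp add: add_eq_0_iff)
    finally show ?thesis by simp
  qed
  then have J0: "\<forall>i\<in>J. c i = 0"
    using insert.IH[of H c] Hpoly Hind by blast
  then have "c k * G k u a = 0"
    using insert.prems(3)[of u] insert.hyps by simp
  then show ?case using \<open>G k u a \<noteq> 0\<close> J0 by simp
qed

section \<open>Coefficients and the rank of families in the exterior algebra\<close>

lemma coeff_0 [simp]: "coeff 0 S = 0"
  by (simp add: zero_exterior.rep_eq)

lemma coeff_add [simp]: "coeff (x + y) S = coeff x S + coeff y S"
  by (simp add: plus_exterior.rep_eq)

lemma coeff_scaleR [simp]: "coeff (c *\<^sub>R x) S = c * coeff x S"
  by (simp add: scaleR_exterior.rep_eq)

lemma coeff_uminus [simp]: "coeff (- x) S = - coeff x S"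
  by (simp add: uminus_exterior.rep_eq)

lemma coeff_sum [simp]: "coeff (\<Sum>i\<in>A. f i) S = (\<Sum>i\<in>A. coeff (f i) S)"
  by (induction A rule: infinite_finite_induct) simp_all

lemma exterior_eqI: "(\<And>S. coeff x S = coeff y S) \<Longrightarrow> x = y"
  by (rule coeff_inject[THEN iffD1]) (rule ext)

text \<open>Choose indices whose vectors form a basis at \<open>b\<close> and read the coefficients
  as a matrix with one column per set \<open>T\<close>; the chosen rows stay independent at the
  generic point. Relations may have arbitrary real coefficients; only the entries are rational
  polynomials.\<close>

lemma generic_dim_ge:
  fixes g :: "'i \<Rightarrow> ('x \<Rightarrow> real) \<Rightarrow> exterior"
  assumes gen: "alg_independent_over_rat I a" and fin: "finite J"
    and poly: "\<And>i T. i \<in> J \<Longrightarrow> (\<lambda>a. coeff (g i a) T) \<in> polyfun I"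
  shows "dim ((\<lambda>i. g i b) ` J) \<le> dim ((\<lambda>i. g i a) ` J)"
proof -
  obtain B where B: "B \<subseteq> (\<lambda>i. g i b) ` J" "independent B"
    "(\<lambda>i. g i b) ` J \<subseteq> span B" "card B = dim ((\<lambda>i. g i b) ` J)"
    by (rule basis_exists)
  obtain J' where J': "J' \<subseteq> J" "inj_on (\<lambda>i. g i b) J'" "B = (\<lambda>i. g i b) ` J'"
    using B(1) unfolding subset_image_inj by blast
  have finJ': "finite J'" using J'(1) fin finite_subset by blast
  have indb: "\<forall>i\<in>J'. c i = 0" if "\<And>T. (\<Sum>i\<in>J'. c i * coeff (g i b) T) = 0" for c
  proof -
    \<comment> \<open>Moves the coefficients from indices to vectors, which is possible because the
      chosen indices give distinct vectors at \<open>b\<close>.\<close>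
    define u where "u = c \<circ> the_inv_into J' (\<lambda>i. g i b)"
    have "(\<Sum>x\<in>B. u x *\<^sub>R x) = (\<Sum>i\<in>J'. c i *\<^sub>R g i b)"
      unfolding J'(3) sum.reindex[OF J'(2)] u_def
      by (intro sum.cong) (simp_all add: the_inv_into_f_f[OF J'(2)])
    also have "\<dots> = 0" by (rule exterior_eqI) (simp add: that)
    finally have "\<forall>x\<in>B. u x = 0"
      using independentD[OF B(2) _ subset_refl, of u] finJ' J'(3) by auto
    then show ?thesis unfolding J'(3) u_def by (simp add: the_inv_into_f_f[OF J'(2)])
  qed
  have inda: "\<forall>i\<in>J'. c i = 0" if "(\<Sum>i\<in>J'. c i *\<^sub>R g i a) = 0" for c
  proof (rule generic_rows_independent[OF gen finJ', where G = "\<lambda>i T a. coeff (g i a) T" and b = b])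
    show "(\<lambda>a. coeff (g i a) T) \<in> polyfun I" if "i \<in> J'" for i T
      using poly that J'(1) by blast
    show "(\<Sum>i\<in>J'. c i * coeff (g i a) T) = 0" for T
      using arg_cong[OF that, of "\<lambda>x. coeff x T"] by simp
  qed (use indb in blast)
  have inj: "inj_on (\<lambda>i. g i a) J'"
  proof (rule inj_onI, rule ccontr)
    fix i k assume ik: "i \<in> J'" "k \<in> J'" "g i a = g k a" "i \<noteq> k"
    \<comment> \<open>If two vectors agreed at \<open>a\<close>, the difference of two indicator
      functions would be a nontrivial relation, so independence of the indexed family also yields
      injectivity.\<close>
    have "(\<Sum>l\<in>J'. ((if l = i then 1 else 0) - (if l = k then 1 else 0)) *\<^sub>R g l a) =
        (\<Sum>l\<in>J'. if l = i then g l a else 0) - (\<Sum>l\<in>J'. if l = k then g l a else 0)"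
      unfolding sum_subtractf[symmetric] by (intro sum.cong) auto
    also have "\<dots> = 0" using ik finJ' by (simp add: sum.delta)
    finally have "\<forall>l\<in>J'. (if l = i then 1 else 0) - (if l = k then 1 else 0) = (0::real)"
      by (rule inda)
    then show False using ik by auto
  qed
  have "independent ((\<lambda>i. g i a) ` J')"
  proof (rule independent_if_scalars_zero)
    fix u x assume u: "(\<Sum>x\<in>(\<lambda>i. g i a) ` J'. u x *\<^sub>R x) = 0" and x: "x \<in> (\<lambda>i. g i a) ` J'"
    have "(\<Sum>i\<in>J'. (u (g i a)) *\<^sub>R g i a) = 0"
      using u by (simp add: sum.reindex[OF inj])
    then show "u x = 0" using inda[of "\<lambda>i. u (g i a)"] x by auto
  qed (use finJ' in simp)
  then have "dim ((\<lambda>i. g i a) ` J') = card J'"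
    by (simp add: dim_eq_card_independent card_image[OF inj])
  moreover have "dim ((\<lambda>i. g i a) ` J') \<le> dim ((\<lambda>i. g i a) ` J)"
    using J'(1) fin by (intro dim_span_mono) (auto intro: span_base)
  moreover have "card B = card J'" unfolding J'(3) by (rule card_image[OF J'(2)])
  ultimately show ?thesis using B(4) by simp
qed

section \<open>Products of anticommuting vectors\<close>

lemma anticommuting_square:
  fixes x :: exterior
  assumes "x * x = - (x * x)"
  shows "x * x = 0"
proof (rule exterior_eqI)
  fix S
  have "coeff (x * x) S = - coeff (x * x) S" using assms by (metis coeff_uminus)
  then show "coeff (x * x) S = coeff 0 S" by simp
qed

context
  fixes v :: "nat \<Rightarrow> exterior"
  assumes anti: "\<And>x y. v x * v y = - (v y * v x)"
begin

lemma anti_left: "v x * (v y * z) = - (v y * (v x * z))"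
  using anti[of x y] by (simp add: mult.assoc[symmetric])

lemma mult_prod_list_repeated:
  assumes "x \<in> set l"
  shows "v x * prod_list (map v l) = 0"
  using assms
proof (induction l)
  case (Cons y l)
  show ?case
  proof (cases "x = y")
    case True
    then show ?thesis
      using anticommuting_square[OF anti] by (simp add: mult.assoc[symmetric])
  next
    case False
    then show ?thesis using Cons by (simp add: anti_left[of x y])
  qed
qed simp

lemma prod_list_not_distinct:
  assumes "\<not> distinct l"
  shows "prod_list (map v l) = 0"
  using assms by (induction l) (auto simp: mult_prod_list_repeated)

text \<open>Each step of the insertion exchanges two adjacent factors and costs a sign. The sign
  stays undetermined, since spans and vanishing do not see it.\<close>

lemma mult_prod_list_insort:
  "v x * prod_list (map v l) = prod_list (map v (insort x l)) \<or>
   v x * prod_list (map v l) = - prod_list (map v (insort x l))"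
proof (induction l)
  case (Cons y l)
  then show ?case by (auto simp: anti_left[of x y])
qed simp

lemma prod_list_wedge_of:
  assumes "distinct l"
  shows "prod_list (map v l) = wedge_of v (set l) \<or> prod_list (map v l) = - wedge_of v (set l)"
  using assms
proof (induction l)
  case Nil
  then show ?case by (simp add: wedge_of_def)
next
  case (Cons x l)
  have "sorted_list_of_set (insert x (set l)) = insort x (sorted_list_of_set (set l))"
    using Cons by simp
  then have "v x * wedge_of v (set l) = wedge_of v (set (x # l)) \<or>
      v x * wedge_of v (set l) = - wedge_of v (set (x # l))"
    using mult_prod_list_insort[of x "sorted_list_of_set (set l)"] by (simp add: wedge_of_def)
  then show ?case using Cons by auto
qed

lemma wedge_of_mult_notin:
  assumes "finite R" "x \<notin> R"
  shows "wedge_of v R * v x = wedge_of v (insert x R) \<or> wedge_of v R * v x = - wedge_of v (insert x R)"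
  using prod_list_wedge_of[of "sorted_list_of_set R @ [x]"] assms by (simp add: wedge_of_def)

lemma wedge_of_mult_in:
  assumes "finite R" "x \<in> R"
  shows "wedge_of v R * v x = 0"
  using prod_list_not_distinct[of "sorted_list_of_set R @ [x]"] assms by (simp add: wedge_of_def)

text \<open>Renumbering by \<open>\<pi>\<close> only reorders the factors of the product over the
  image of \<open>T\<close>. This is what allows rows of the matrix to be exchanged.\<close>

lemma wedge_of_comp:
  assumes "finite T" "inj_on \<pi> T"
  shows "wedge_of (v \<circ> \<pi>) T = wedge_of v (\<pi> ` T) \<or> wedge_of (v \<circ> \<pi>) T = - wedge_of v (\<pi> ` T)"
  using prod_list_wedge_of[of "map \<pi> (sorted_list_of_set T)"] assms
  by (simp add: wedge_of_def distinct_map)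

end

lemma generic_vec_anticommute:
  "generic_vec n \<alpha> i * generic_vec n \<alpha> k = - (generic_vec n \<alpha> k * generic_vec n \<alpha> i)"
proof -
  have "generic_vec n \<alpha> i * generic_vec n \<alpha> k =
      (\<Sum>l=1..n. \<Sum>j=1..n. (\<alpha> i j * \<alpha> k l) *\<^sub>R (ext_gen j * ext_gen l))"
    unfolding generic_vec_def sum_product by (subst sum.swap) (simp add: mult.commute)
  also have "\<dots> = - (\<Sum>l=1..n. \<Sum>j=1..n. (\<alpha> i j * \<alpha> k l) *\<^sub>R (ext_gen l * ext_gen j))"
    unfolding sum_negf[symmetric]
    by (intro sum.cong refl) (subst ext_gen_anticommute, rule scaleR_minus_right)
  also have "\<dots> = - (generic_vec n \<alpha> k * generic_vec n \<alpha> i)"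
    unfolding generic_vec_def sum_product by (simp add: mult.commute)
  finally show ?thesis .
qed

lemmas generic_wedge_mult_notin =
  wedge_of_mult_notin[of "generic_vec n \<alpha>" for n \<alpha>, OF generic_vec_anticommute]
lemmas generic_wedge_mult_in =
  wedge_of_mult_in[of "generic_vec n \<alpha>" for n \<alpha>, OF generic_vec_anticommute]
lemmas generic_wedge_comp =
  wedge_of_comp[of "generic_vec n \<alpha>" for n \<alpha>, OF generic_vec_anticommute]

section \<open>The exterior face ring as a space of coefficients\<close>

text \<open>A model of the quotient map: for a complex \<open>K\<close>, the kernel of this
  coordinate projection on \<open>ext_alg n\<close> is the nonface ideal, by
  \<open>in_nonface_ideal_iff\<close>.\<close>

lift_definition restrict_ext :: "nat set set \<Rightarrow> exterior \<Rightarrow> exterior"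
  is "\<lambda>K f S. if S \<in> K then f S else 0"
proof -
  fix K :: "nat set set" and f :: "nat set \<Rightarrow> real"
  assume "finite {S. f S \<noteq> 0} \<and> (\<forall>S. f S \<noteq> 0 \<longrightarrow> finite S)"
  then show "finite {S. (if S \<in> K then f S else 0) \<noteq> 0} \<and>
      (\<forall>S. (if S \<in> K then f S else 0) \<noteq> 0 \<longrightarrow> finite S)"
    by (auto elim!: rev_finite_subset)
qed

lemma coeff_restrict_ext [simp]: "coeff (restrict_ext K x) S = (if S \<in> K then coeff x S else 0)"
  by (simp add: restrict_ext.rep_eq)

lemma linear_restrict_ext: "linear (restrict_ext K)"
  by (rule linearI; rule exterior_eqI) simp_all

lemma coeff_mult: "coeff (x * y) U = (\<Sum>S\<in>Pow U. shuffle_sign S (U - S) * coeff x S * coeff y (U - S))"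
  by (simp add: times_exterior.rep_eq wedge_coeff_def)

lemma coeff_mult_nonzeroE:
  assumes "coeff (x * y) U \<noteq> 0"
  obtains S where "finite U" "S \<subseteq> U" "coeff x S \<noteq> 0" "coeff y (U - S) \<noteq> 0"
  using assms by (metis times_exterior.rep_eq wedge_coeff_nonzeroE)

lemma coeff_ext_gen: "coeff (ext_gen i) S = (if S = {i} then 1 else 0)"
  by (simp add: ext_gen.rep_eq)

lemma ext_alg_iff: "x \<in> ext_alg n \<longleftrightarrow> (\<forall>U. coeff x U \<noteq> 0 \<longrightarrow> U \<subseteq> {1..n})"
proof
  assume "x \<in> ext_alg n"
  then show "\<forall>U. coeff x U \<noteq> 0 \<longrightarrow> U \<subseteq> {1..n}"
    unfolding ext_alg_def
  proof (induction rule: span_induct_alt)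
    case base
    then show ?case by simp
  next
    case (step c x y)
    then obtain S where S: "S \<subseteq> {1..n}" "x = ext_basis S" by auto
    then have "finite S" using finite_subset by blast
    then show ?case using step S by (auto simp: coeff_ext_basis split: if_splits)
  qed
next
  assume supp: "\<forall>U. coeff x U \<noteq> 0 \<longrightarrow> U \<subseteq> {1..n}"
  have "x = (\<Sum>U\<in>Pow {1..n}. coeff x U *\<^sub>R ext_basis U)"
  proof (rule exterior_eqI)
    fix S
    have "coeff (\<Sum>U\<in>Pow {1..n}. coeff x U *\<^sub>R ext_basis U) S =
        (\<Sum>U\<in>Pow {1..n}. if S = U then coeff x U else 0)"
      unfolding coeff_sum
      by (intro sum.cong refl) (simp add: coeff_ext_basis finite_subset[OF _ finite_atLeastAtMost[of 1 n]])
    also have "\<dots> = coeff x S" using supp by (auto simp: sum.delta)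
    finally show "coeff x S = coeff (\<Sum>U\<in>Pow {1..n}. coeff x U *\<^sub>R ext_basis U) S" by simp
  qed
  also have "\<dots> \<in> ext_alg n"
    unfolding ext_alg_def by (intro span_sum span_scale span_base) auto
  finally show "x \<in> ext_alg n" .
qed

lemma one_in_ext_alg: "1 \<in> ext_alg n"
  by (auto simp: ext_alg_iff one_exterior.rep_eq split: if_splits)

lemma mult_in_ext_alg: "x \<in> ext_alg n \<Longrightarrow> y \<in> ext_alg n \<Longrightarrow> x * y \<in> ext_alg n"
  unfolding ext_alg_iff by (blast elim: coeff_mult_nonzeroE)

lemma coeff_generic_vec:
  "coeff (generic_vec n \<alpha> i) S = (\<Sum>j=1..n. if S = {j} then \<alpha> i j else 0)"
  unfolding generic_vec_def coeff_sum by (intro sum.cong) (auto simp: coeff_ext_gen)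

lemma generic_vec_in_ext_alg: "generic_vec n \<alpha> i \<in> ext_alg n"
proof -
  have "ext_gen j \<in> ext_alg n" if "j \<in> {1..n}" for j
    using that by (auto simp: ext_alg_iff coeff_ext_gen split: if_splits)
  then show ?thesis
    unfolding generic_vec_def ext_alg_def by (intro span_sum span_scale)
qed

lemma wedge_of_in_ext_alg:
  assumes "\<And>i. v i \<in> ext_alg n"
  shows "wedge_of v S \<in> ext_alg n"
proof -
  have "prod_list (map v l) \<in> ext_alg n" for l
    by (induction l) (simp_all add: one_in_ext_alg mult_in_ext_alg assms)
  then show ?thesis by (simp add: wedge_of_def)
qed

text \<open>Every term of \<open>x * ext_basis T * y\<close> sits at a superset of \<open>T\<close>,
  again a nonface because complexes are closed under subsets. Conversely, an element without
  coefficients at faces is a combination of nonface basis elements.\<close>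

lemma in_nonface_ideal_iff:
  assumes K: "abstract_simplicial_complex K" and x: "x \<in> ext_alg n"
  shows "x \<in> nonface_ideal n K \<longleftrightarrow> restrict_ext K x = 0"
proof
  assume "x \<in> nonface_ideal n K"
  then show "restrict_ext K x = 0"
    unfolding nonface_ideal_def
  proof (induction rule: span_induct_alt)
    case base
    then show ?case by (simp add: linear_0[OF linear_restrict_ext])
  next
    case (step c z w)
    then obtain y T y' where z: "z = y * ext_basis T * y'" "T \<subseteq> {1..n}" "T \<notin> K" by auto
    have "finite T" using z(2) finite_subset by blast
    have "coeff z U = 0" if "U \<in> K" for U
    proof (rule ccontr)
      assume "coeff z U \<noteq> 0"
      then obtain S where S: "S \<subseteq> U" "coeff (y * ext_basis T) S \<noteq> 0"
        unfolding z by (rule coeff_mult_nonzeroE)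
      from this(2) obtain R where "R \<subseteq> S" "coeff (ext_basis T) (S - R) \<noteq> 0"
        by (rule coeff_mult_nonzeroE)
      then have "T \<subseteq> U" using S(1) \<open>finite T\<close> by (auto simp: coeff_ext_basis split: if_splits)
      then show False using K that z(3) unfolding abstract_simplicial_complex_def by blast
    qed
    then have "restrict_ext K z = 0" by (intro exterior_eqI) simp
    then show ?case
      using step by (simp add: linear_add[OF linear_restrict_ext] linear_scale[OF linear_restrict_ext])
  qed
next
  assume x0: "restrict_ext K x = 0"
  have van: "coeff x U = 0" if "U \<in> K" for U
    using arg_cong[OF x0, of "\<lambda>y. coeff y U"] that by simp
  \<comment> \<open>The factors 1 give each summand the shape of the generators of the
    ideal.\<close>
  have "x = (\<Sum>U\<in>Pow {1..n} - K. coeff x U *\<^sub>R (1 * ext_basis U * 1))"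
  proof (rule exterior_eqI)
    fix S
    have "coeff (\<Sum>U\<in>Pow {1..n} - K. coeff x U *\<^sub>R (1 * ext_basis U * 1)) S =
        (\<Sum>U\<in>Pow {1..n} - K. if S = U then coeff x U else 0)"
      unfolding coeff_sum
      by (intro sum.cong refl) (simp add: coeff_ext_basis finite_subset[OF _ finite_atLeastAtMost[of 1 n]])
    also have "\<dots> = coeff x S" using x van by (auto simp: sum.delta ext_alg_iff)
    finally show "coeff x S = coeff (\<Sum>U\<in>Pow {1..n} - K. coeff x U *\<^sub>R (1 * ext_basis U * 1)) S" by simp
  qed
  also have "\<dots> \<in> nonface_ideal n K"
    unfolding nonface_ideal_def
    by (intro span_sum span_scale span_base) (use one_in_ext_alg in blast)
  finally show "x \<in> nonface_ideal n K" .
qed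

text \<open>The class of \<open>f_S\<close> in the exterior face ring, represented by its
  coefficients at the faces of \<open>K\<close>.\<close>

definition face_vec :: "nat \<Rightarrow> (nat \<Rightarrow> nat \<Rightarrow> real) \<Rightarrow> nat set set \<Rightarrow> nat set \<Rightarrow> exterior" where
  "face_vec n \<alpha> K S = restrict_ext K (wedge_of (generic_vec n \<alpha>) S)"

definition lex_below :: "nat \<Rightarrow> nat set \<Rightarrow> nat set set" where
  "lex_below n S = {S'. S' \<subseteq> {1..n} \<and> card S' = card S \<and> S' <\<^sub>L S}"

text \<open>Two cosets agree when the difference of representatives lies in the kernel of the
  projection, and a linear map sends spans to spans. From here on cosets are replaced by vectors of
  coefficients.\<close>

lemma in_algebraic_shifting_iff:
  assumes K: "abstract_simplicial_complex K"
  shows "S \<in> algebraic_shifting n \<alpha> K \<longleftrightarrow>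
    S \<subseteq> {1..n} \<and> face_vec n \<alpha> K S \<notin> span (face_vec n \<alpha> K ` lex_below n S)"
proof -
  let ?f = "wedge_of (generic_vec n \<alpha>)"
  let ?N = "nonface_ideal n K"
  have falg: "?f T \<in> ext_alg n" for T
    by (intro wedge_of_in_ext_alg generic_vec_in_ext_alg)
  have coset: "x +o ?N = y +o ?N \<longleftrightarrow> x - y \<in> ?N" for x y
  proof
    have "0 \<in> ?N" unfolding nonface_ideal_def by (rule span_zero)
    assume "x +o ?N = y +o ?N"
    moreover have "x + 0 \<in> x +o ?N"
      using \<open>0 \<in> ?N\<close> by (rule set_plus_intro2)
    ultimately have "x \<in> y +o ?N" by simp
    then obtain b where "b \<in> ?N" "x = y + b" unfolding elt_set_plus_def by blast
    then show "x - y \<in> ?N" by simp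
  next
    assume d: "x - y \<in> ?N"
    have plus: "a + b \<in> ?N" and minus: "a - b \<in> ?N" if "a \<in> ?N" "b \<in> ?N" for a b
      using that unfolding nonface_ideal_def by (auto intro: span_add span_diff)
    show "x +o ?N = y +o ?N"
    proof (intro equalityI subsetI)
      fix z assume "z \<in> x +o ?N"
      then obtain b where "b \<in> ?N" "z = x + b" unfolding elt_set_plus_def by blast
      then have "z = y + ((x - y) + b)" "(x - y) + b \<in> ?N" using plus[OF d] by auto
      then show "z \<in> y +o ?N" unfolding elt_set_plus_def by blast
    next
      fix z assume "z \<in> y +o ?N"
      then obtain b where "b \<in> ?N" "z = y + b" unfolding elt_set_plus_def by blast
      then have "z = x + (b - (x - y))" "b - (x - y) \<in> ?N" using minus[OF _ d] by auto
      then show "z \<in> x +o ?N" unfolding elt_set_plus_def by blast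
    qed
  qed
  have set_eq: "{?f S' |S'. S' \<subseteq> {1..n} \<and> card S' = card S \<and> S' <\<^sub>L S} = ?f ` lex_below n S"
    unfolding lex_below_def by auto
  have "?f S +o ?N \<in> (\<lambda>x. x +o ?N) ` span (?f ` lex_below n S) \<longleftrightarrow>
      (\<exists>y\<in>span (?f ` lex_below n S). ?f S - y \<in> ?N)"
    by (auto simp: coset image_iff)
  also have "\<dots> \<longleftrightarrow> (\<exists>y\<in>span (?f ` lex_below n S). restrict_ext K (?f S) = restrict_ext K y)"
  proof (rule bex_cong[OF refl])
    fix y assume "y \<in> span (?f ` lex_below n S)"
    moreover have "span (?f ` lex_below n S) \<subseteq> ext_alg n"
      using falg unfolding ext_alg_def by (intro span_minimal) auto
    ultimately have "?f S - y \<in> ext_alg n"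
      using falg[of S] unfolding ext_alg_def by (intro span_diff) auto
    then show "?f S - y \<in> ?N \<longleftrightarrow> restrict_ext K (?f S) = restrict_ext K y"
      by (simp add: in_nonface_ideal_iff[OF K] linear_diff[OF linear_restrict_ext])
  qed
  also have "\<dots> \<longleftrightarrow> face_vec n \<alpha> K S \<in> span (face_vec n \<alpha> K ` lex_below n S)"
    using linear_span_image[OF linear_restrict_ext, of K "?f ` lex_below n S"]
    unfolding face_vec_def[abs_def] by (auto simp: image_image)
  finally have eq: "?f S +o ?N \<in> (\<lambda>x. x +o ?N) ` span (?f ` lex_below n S) \<longleftrightarrow>
      face_vec n \<alpha> K S \<in> span (face_vec n \<alpha> K ` lex_below n S)" .
  show ?thesis
    unfolding algebraic_shifting_def Let_def mem_Collect_eq set_eq eq ..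
qed

section \<open>Dependence of the face vectors on the entries and the size of the matrix\<close>

lemma face_subset_vertices:
  assumes "abstract_simplicial_complex K" "T \<in> K"
  shows "T \<subseteq> vertices K"
  using assms unfolding abstract_simplicial_complex_def vertices_def by blast

lemma coeff_generic_vec_cong:
  assumes "S \<subseteq> {1..n}" "S \<subseteq> {1..p}"
  shows "coeff (generic_vec n \<alpha> i) S = coeff (generic_vec p \<alpha> i) S"
proof (cases "\<exists>j. S = {j}")
  case True
  then obtain j where "S = {j}" by blast
  then show ?thesis
    using assms by (simp add: coeff_generic_vec sum.delta eq_commute[of j])
next
  case False
  then show ?thesis by (simp add: coeff_generic_vec)
qed

text \<open>Only columns in \<open>T\<close> contribute to the coefficient at \<open>T\<close>. This
  makes matrices of different sizes comparable.\<close>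

lemma coeff_wedge_of_generic_vec_cong:
  assumes "T \<subseteq> {1..n}" "T \<subseteq> {1..p}"
  shows "coeff (wedge_of (generic_vec n \<alpha>) S) T = coeff (wedge_of (generic_vec p \<alpha>) S) T"
proof -
  have "coeff (prod_list (map (generic_vec n \<alpha>) l)) T = coeff (prod_list (map (generic_vec p \<alpha>) l)) T" for l
    using assms
  proof (induction l arbitrary: T)
    case (Cons i l)
    have "coeff (generic_vec n \<alpha> i) R * coeff (prod_list (map (generic_vec n \<alpha>) l)) (T - R) =
        coeff (generic_vec p \<alpha> i) R * coeff (prod_list (map (generic_vec p \<alpha>) l)) (T - R)"
      if "R \<in> Pow T" for R
      using that Cons.prems
      by (intro arg_cong2[where f = "(*)"] coeff_generic_vec_cong Cons.IH) auto
    then show ?case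
      by (simp add: coeff_mult mult.assoc)
  qed simp
  then show ?thesis by (simp add: wedge_of_def)
qed

lemma face_vec_cong:
  assumes "\<And>T. T \<in> K \<Longrightarrow> T \<subseteq> {1..n}" "\<And>T. T \<in> K \<Longrightarrow> T \<subseteq> {1..p}"
  shows "face_vec n \<alpha> K S = face_vec p \<alpha> K S"
  unfolding face_vec_def
  by (rule exterior_eqI) (use coeff_wedge_of_generic_vec_cong assms in auto)

lemma coeff_generic_vec_polyfun:
  assumes "i \<in> R" "S \<subseteq> V"
  shows "(\<lambda>a. coeff (generic_vec n (\<lambda>i j. a (i, j)) i) S) \<in> polyfun (R \<times> V)"
  unfolding coeff_generic_vec
proof (rule polyfun_sum)
  fix j
  show "(\<lambda>a. if S = {j} then a (i, j) else 0) \<in> polyfun (R \<times> V)"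
    by (cases "S = {j}") (use assms in \<open>auto simp: polyfun_0 intro: polyfun.var\<close>)
qed

text \<open>For \<open>T\<close> within \<open>{1..n}\<close> the coefficient is a minor of the
  matrix; expanding the product factor by factor shows that it is polynomial without any theory of
  determinants.\<close>

lemma coeff_wedge_of_polyfun:
  assumes "finite S" "S \<subseteq> R" "T \<subseteq> V"
  shows "(\<lambda>a. coeff (wedge_of (generic_vec n (\<lambda>i j. a (i, j))) S) T) \<in> polyfun (R \<times> V)"
proof -
  have "(\<lambda>a. coeff (prod_list (map (generic_vec n (\<lambda>i j. a (i, j))) l)) T) \<in> polyfun (R \<times> V)"
    if "set l \<subseteq> R" for l
    using that assms(3)
  proof (induction l arbitrary: T)
    case Nil
    then show ?case by (simp add: one_exterior.rep_eq polyfun_0 polyfun_1)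
  next
    case (Cons i l)
    have sign: "(\<lambda>_. shuffle_sign S U) \<in> polyfun (R \<times> V)" for S U
      using polyfun.const[of "(- 1) ^ card {(s, t). s \<in> S \<and> t \<in> U \<and> t < s}" "R \<times> V"]
      by (simp add: shuffle_sign_def of_rat_power of_rat_minus)
    show ?case
      unfolding list.map prod_list.Cons coeff_mult
      using Cons.prems
      by (intro polyfun_sum polyfun.mult sign coeff_generic_vec_polyfun Cons.IH) auto
  qed
  then show ?thesis
    using assms by (simp add: wedge_of_def)
qed

lemma coeff_face_vec_polyfun:
  assumes "finite S" "S \<subseteq> R" "\<And>T. T \<in> K \<Longrightarrow> T \<subseteq> V"
  shows "(\<lambda>a. coeff (face_vec n (\<lambda>i j. a (i, j)) K S) T) \<in> polyfun (R \<times> V)"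
  using coeff_wedge_of_polyfun[OF assms(1,2), of T V n] assms(3)
  by (cases "T \<in> K") (simp_all add: face_vec_def polyfun_0)

text \<open>The rank principle with rows \<open>J\<close> and the faces of \<open>K\<close> as
  columns. The matrix \<open>\<beta>\<close> is arbitrary: it may be another generic matrix, or
  \<open>\<alpha>\<close> with two rows exchanged.\<close>

lemma dim_face_vec_generic_ge:
  assumes K: "abstract_simplicial_complex K" and "admissible m \<alpha> K"
    and "J \<subseteq> Pow {1..m}"
  shows "dim (face_vec m \<beta> K ` J) \<le> dim (face_vec m \<alpha> K ` J)"
proof -
  define V where "V = vertices K"
  have V: "V \<subseteq> {1..m}" and gen: "alg_independent_over_rat ({1..m} \<times> {1..m}) (\<lambda>(i, j). \<alpha> i j)"
    using assms(2) by (auto simp: admissible_def generic_matrix_def V_def)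
  have "dim ((\<lambda>S. face_vec m (\<lambda>i j. (\<lambda>(i, j). \<beta> i j) (i, j)) K S) ` J)
      \<le> dim ((\<lambda>S. face_vec m (\<lambda>i j. (\<lambda>(i, j). \<alpha> i j) (i, j)) K S) ` J)"
  proof (rule generic_dim_ge[OF gen, of J "\<lambda>S a. face_vec m (\<lambda>i j. a (i, j)) K S"])
    show "finite J" using assms(3) by (rule finite_subset) simp
    show "(\<lambda>a. coeff (face_vec m (\<lambda>i j. a (i, j)) K S) T) \<in> polyfun ({1..m} \<times> {1..m})"
      if "S \<in> J" for S T
      using that assms(3) V face_subset_vertices[OF K] unfolding V_def
      by (intro coeff_face_vec_polyfun) (blast intro: finite_subset[OF _ finite_atLeastAtMost])+
  qed
  then show ?thesis by simp
qed

section \<open>Lexicographic order\<close>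

text \<open>The minimum of the symmetric difference is replaced by a first point of disagreement, so
  that later comparisons become comparisons of such points.\<close>

lemma lex_less_iff:
  assumes "finite S" "finite T"
  shows "S <\<^sub>L T \<longleftrightarrow> card S = card T \<and> (\<exists>x\<in>S - T. S \<inter> {..<x} = T \<inter> {..<x})"
proof
  let ?D = "(S - T) \<union> (T - S)"
  assume lt: "S <\<^sub>L T"
  then have D: "finite ?D" "?D \<noteq> {}" using assms by (auto simp: lex_less_def)
  define x where "x = Min ?D"
  have x: "x \<in> ?D" "\<forall>y\<in>?D. x \<le> y"
    unfolding x_def by (rule Min_in[OF D], rule ballI, rule Min_le[OF D(1)])
  have "x \<in> S" using lt unfolding lex_less_def x_def by (elim conjE)
  then have "x \<in> S - T" using x(1) by blast
  moreover have "S \<inter> {..<x} = T \<inter> {..<x}"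
    using x(2) by (auto simp: not_less[symmetric])
  ultimately show "card S = card T \<and> (\<exists>x\<in>S - T. S \<inter> {..<x} = T \<inter> {..<x})"
    using lt by (auto simp: lex_less_def)
next
  let ?D = "(S - T) \<union> (T - S)"
  assume "card S = card T \<and> (\<exists>x\<in>S - T. S \<inter> {..<x} = T \<inter> {..<x})"
  then obtain x where x: "card S = card T" "x \<in> S - T" "S \<inter> {..<x} = T \<inter> {..<x}" by blast
  have "x \<le> y" if "y \<in> ?D" for y
  proof (rule ccontr)
    assume "\<not> x \<le> y"
    then have "y \<in> {..<x}" by simp
    then have "y \<in> S \<longleftrightarrow> y \<in> T" using x(3) by blast
    then show False using that by blast
  qed
  then have "Min ?D = x" using x(2) assms by (intro Min_eqI) auto
  then show "S <\<^sub>L T" using x(1,2) unfolding lex_less_def by auto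
qed

lemma lex_less_trans:
  assumes "finite S" "finite T" "finite U" "S <\<^sub>L T" "T <\<^sub>L U"
  shows "S <\<^sub>L U"
proof -
  obtain x where x: "card S = card T" "x \<in> S - T" "S \<inter> {..<x} = T \<inter> {..<x}"
    using assms lex_less_iff by blast
  obtain y where y: "card T = card U" "y \<in> T - U" "T \<inter> {..<y} = U \<inter> {..<y}"
    using assms lex_less_iff by blast
  have agree: "w \<in> S \<longleftrightarrow> w \<in> T" if "w < x" for w
    using x(3) that by (metis Int_iff lessThan_iff)
  have agree': "w \<in> T \<longleftrightarrow> w \<in> U" if "w < y" for w
    using y(3) that by (metis Int_iff lessThan_iff)
  \<comment> \<open>\<open>T\<close> contains \<open>y\<close> but not \<open>x\<close>. The first
    disagreement of \<open>S\<close> and \<open>U\<close> is the smaller of the two.\<close>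
  have "x \<noteq> y" using x y by auto
  then have "min x y \<in> S - U"
    using agree[of y] agree'[of x] x(2) y(2) by (cases "x < y") (auto simp: min_def)
  moreover have "S \<inter> {..<min x y} = U \<inter> {..<min x y}"
    using agree agree' by auto
  ultimately show ?thesis
    using lex_less_iff[of S U] assms x(1) y(1) by auto
qed

lemma lex_less_asym:
  assumes "finite S" "finite T" "S <\<^sub>L T"
  shows "\<not> T <\<^sub>L S"
proof
  assume "T <\<^sub>L S"
  then have "S <\<^sub>L S" using lex_less_trans assms by blast
  then show False by (simp add: lex_less_def)
qed

lemma lex_less_total:
  assumes "finite S" "finite T" "card S = card T" "S \<noteq> T"
  shows "S <\<^sub>L T \<or> T <\<^sub>L S"
proof -
  let ?D = "(S - T) \<union> (T - S)"
  have "Min ?D \<in> ?D" using assms by (intro Min_in) auto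
  then show ?thesis using assms by (auto simp: lex_less_def Un_commute)
qed

lemma lex_below_trans:
  assumes "S \<subseteq> {1..n}" "T \<in> lex_below n S"
  shows "lex_below n T \<subseteq> lex_below n S"
proof
  fix U assume U: "U \<in> lex_below n T"
  have "finite U" "finite T" "finite S"
    using assms U finite_subset[OF _ finite_atLeastAtMost[of 1 n]] by (auto simp: lex_below_def)
  then show "U \<in> lex_below n S"
    using assms U lex_less_trans[of U T S] by (auto simp: lex_below_def)
qed

lemma lex_below_finite: "finite (lex_below n S)"
  by (rule finite_subset[of _ "Pow {1..n}"]) (auto simp: lex_below_def)

text \<open>In a down-closed family of sets of one size, the predecessors inside \<open>J\<close>
  are all the predecessors, so the greedy selection from \<open>J\<close> picks exactly the members
  of the shifted complex.\<close>

lemma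
  assumes K: "abstract_simplicial_complex K"
    and J: "J \<subseteq> Pow {1..n}" and card_J: "\<And>S. S \<in> J \<Longrightarrow> card S = k"
    and down: "\<And>S. S \<in> J \<Longrightarrow> lex_below n S \<subseteq> J"
  shows dim_eq_card_shifting: "dim (face_vec n \<alpha> K ` J) = card (J \<inter> algebraic_shifting n \<alpha> K)"
    and span_shifting: "span (face_vec n \<alpha> K ` (J \<inter> algebraic_shifting n \<alpha> K)) = span (face_vec n \<alpha> K ` J)"
proof -
  have fin: "finite S" if "S \<in> J" for S
    using that J finite_subset[OF _ finite_atLeastAtMost[of 1 n]] by auto
  have "finite J" using J by (rule finite_subset) simp
  moreover have "transp_on J (<\<^sub>L)"
    by (rule transp_onI) (blast intro: lex_less_trans fin)
  moreover have "asymp_on J (<\<^sub>L)"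
    by (rule asymp_onI) (blast dest: lex_less_asym[OF fin fin])
  moreover have "totalp_on J (<\<^sub>L)"
    by (rule totalp_onI) (simp add: lex_less_total fin card_J)
  ultimately have greedy: "finite J" "transp_on J (<\<^sub>L)" "asymp_on J (<\<^sub>L)" "totalp_on J (<\<^sub>L)" .
  have below: "{T \<in> J. T <\<^sub>L S} = lex_below n S" if "S \<in> J" for S
    using that J down[OF that] card_J by (auto simp: lex_below_def)
  have "{S \<in> J. face_vec n \<alpha> K S \<notin> span (face_vec n \<alpha> K ` {T \<in> J. T <\<^sub>L S})} =
      J \<inter> algebraic_shifting n \<alpha> K"
    using J by (auto simp: in_algebraic_shifting_iff[OF K] below)
  then show "dim (face_vec n \<alpha> K ` J) = card (J \<inter> algebraic_shifting n \<alpha> K)"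
    "span (face_vec n \<alpha> K ` (J \<inter> algebraic_shifting n \<alpha> K)) = span (face_vec n \<alpha> K ` J)"
    using dim_eq_card_greedy[OF greedy, of "face_vec n \<alpha> K"] greedy_basis(3)[OF greedy, of "face_vec n \<alpha> K"]
    by simp_all
qed

section \<open>Independence of the shifted complex of the generic matrix\<close>

text \<open>Specialising the first \<open>card V\<close> rows to the unit vectors of
  \<open>V\<close> completes the remaining unit vectors to the standard basis. The rank at the
  generic point is at least as large, hence full.\<close>

lemma generic_vecs_span:
  assumes gen: "generic_matrix N \<alpha>" and V: "V \<subseteq> {1..N}"
  shows "span (generic_vec N \<alpha> ` {1..card V} \<union> ext_gen ` ({1..N} - V)) = span (ext_gen ` {1..N})"
proof -
  define v where "v = card V"
  have finV: "finite V" using V finite_subset by blast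
  have v: "v \<le> N" using card_mono[OF _ V] by (simp add: v_def)
  obtain h where h: "bij_betw h {1..v} V"
    using finite_same_card_bij[of "{1..v}" V] finV v_def by auto
  have "card ({1..N} - V) = card {v+1..N}"
    using V finV by (simp add: card_Diff_subset v_def)
  then obtain k where k: "bij_betw k {v+1..N} ({1..N} - V)"
    using finite_same_card_bij[of "{v+1..N}" "{1..N} - V"] by auto
  \<comment> \<open>One polynomial family holds both kinds of vectors: the first \<open>v\<close>
    depend on the matrix, the others are constant.\<close>
  define g where "g i a = (if i \<le> v then generic_vec N (\<lambda>i j. a (i, j)) i else ext_gen (k i))"
    for i and a :: "nat \<times> nat \<Rightarrow> real"
  \<comment> \<open>The specialisation: row \<open>i\<close> with \<open>i \<le> v\<close> becomes
    the unit vector at \<open>h i\<close>.\<close>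
  define b where "b = (\<lambda>(i, j). if j = h i then 1 else 0 :: real)"
  let ?a = "\<lambda>(i, j). \<alpha> i j"
  have split: "{1..N} = {1..v} \<union> {v+1..N}" using v by auto
  have "dim ((\<lambda>i. g i b) ` {1..N}) \<le> dim ((\<lambda>i. g i ?a) ` {1..N})"
  proof (rule generic_dim_ge)
    show "alg_independent_over_rat ({1..N} \<times> {1..N}) ?a"
      using gen by (simp add: generic_matrix_def)
    fix i T assume i: "i \<in> {1..N}"
    show "(\<lambda>a. coeff (g i a) T) \<in> polyfun ({1..N} \<times> {1..N})"
    proof (cases "i \<le> v")
      case True
      show ?thesis
      proof (cases "T \<subseteq> {1..N}")
        case T: True
        show ?thesis
          using coeff_generic_vec_polyfun[OF i T] True by (simp add: g_def)
      next
        case False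
        have "coeff (generic_vec N \<beta> i) T = 0" for \<beta>
          using generic_vec_in_ext_alg[of N \<beta> i] False by (auto simp: ext_alg_iff)
        then show ?thesis using True by (simp add: g_def polyfun_0)
      qed
    next
      case False
      then show ?thesis by (simp add: g_def coeff_ext_gen polyfun_0 polyfun_1)
    qed
  qed simp
  moreover have "(\<lambda>i. g i b) ` {1..N} = ext_gen ` {1..N}"
  proof -
    have "g i b = ext_gen (h i)" if "i \<in> {1..v}" for i
    proof -
      have "h i \<in> V" using h that by (rule bij_betwE[rule_format])
      then have "h i \<in> {1..N}" using V by blast
      moreover have "g i b = (\<Sum>j=1..N. if j = h i then ext_gen j else 0)"
        using that unfolding g_def generic_vec_def b_def
        by (simp only: atLeastAtMost_iff if_True split_conv) (intro sum.cong, auto)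
      ultimately show ?thesis by simp
    qed
    then have "(\<lambda>i. g i b) ` {1..v} = ext_gen ` h ` {1..v}"
      by (force simp: image_image intro!: image_cong)
    moreover have "(\<lambda>i. g i b) ` {v+1..N} = ext_gen ` k ` {v+1..N}"
      by (force simp: image_image g_def intro!: image_cong)
    ultimately show ?thesis
      using h k V unfolding split image_Un by (auto simp: bij_betw_def image_Un[symmetric])
  qed
  moreover have a_eq: "(\<lambda>i. g i ?a) ` {1..N} = generic_vec N \<alpha> ` {1..v} \<union> ext_gen ` ({1..N} - V)"
  proof -
    have "(\<lambda>i. g i ?a) ` {1..v} = generic_vec N \<alpha> ` {1..v}"
      by (intro image_cong) (auto simp: g_def)
    moreover have "(\<lambda>i. g i ?a) ` {v+1..N} = ext_gen ` k ` {v+1..N}"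
      by (force simp: image_image g_def intro!: image_cong)
    ultimately show ?thesis
      using k unfolding split image_Un by (simp add: bij_betw_def)
  qed
  moreover have "generic_vec N \<alpha> ` {1..v} \<union> ext_gen ` ({1..N} - V) \<subseteq> span (ext_gen ` {1..N})"
    unfolding generic_vec_def by (auto intro!: span_sum span_scale intro: span_base)
  ultimately show ?thesis
    unfolding v_def by (intro span_eq_if_dim_ge) auto
qed

lemma restrict_ext_mult_nonvertex:
  assumes "abstract_simplicial_complex K" "c \<notin> vertices K"
  shows "restrict_ext K (x * ext_gen c) = 0"
proof (rule exterior_eqI)
  fix U
  have "coeff (x * ext_gen c) U = 0" if "U \<in> K"
  proof (rule ccontr)
    assume "coeff (x * ext_gen c) U \<noteq> 0"
    then obtain S where "S \<subseteq> U" "coeff (ext_gen c) (U - S) \<noteq> 0"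
      by (rule coeff_mult_nonzeroE)
    then have "c \<in> U" by (auto simp: coeff_ext_gen split: if_splits)
    then show False using face_subset_vertices[OF assms(1) that] assms(2) by blast
  qed
  then show "coeff (restrict_ext K (x * ext_gen c)) U = coeff 0 U" by simp
qed

lemma linear_mult_restrict: "linear (\<lambda>y. restrict_ext K (x * y))"
  by (rule linearI) (simp_all add: distrib_left linear_add[OF linear_restrict_ext] linear_scale[OF linear_restrict_ext])

lemma generic_wedge_mult_cases:
  assumes "finite R"
  shows "wedge_of (generic_vec n \<alpha>) R * generic_vec n \<alpha> i = 0 \<or>
    i \<notin> R \<and> (wedge_of (generic_vec n \<alpha>) R * generic_vec n \<alpha> i = wedge_of (generic_vec n \<alpha>) (insert i R) \<or>
      wedge_of (generic_vec n \<alpha>) R * generic_vec n \<alpha> i = - wedge_of (generic_vec n \<alpha>) (insert i R))"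
  using generic_wedge_mult_in[of R i] generic_wedge_mult_notin[of R i] assms by blast

text \<open>If \<open>S\<close> had an element \<open>i\<close> beyond the number \<open>v\<close>
  of vertices, then \<open>f_i\<close> would be a combination of \<open>f_1, ..., f_v\<close> and of
  \<open>e_c\<close> for nonvertices \<open>c\<close>. Multiplied by \<open>f_R\<close> with
  \<open>R = S - {i}\<close>, the former give 0 or, up to sign, \<open>f\<close> of a
  lexicographically smaller set, and the latter vanish in the face ring.\<close>

lemma shifting_subset_vertices:
  assumes K: "abstract_simplicial_complex K" and adm: "admissible N \<alpha> K"
    and S: "S \<in> algebraic_shifting N \<alpha> K"
  shows "S \<subseteq> {1..card (vertices K)}"
proof (rule ccontr)
  define V where "V = vertices K"
  define v where "v = card V"
  have V: "V \<subseteq> {1..N}" and gen: "generic_matrix N \<alpha>"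
    using adm by (auto simp: admissible_def V_def)
  have v: "v \<le> N" using card_mono[OF _ V] by (simp add: v_def)
  have SN: "S \<subseteq> {1..N}" using S by (simp add: in_algebraic_shifting_iff[OF K])
  then have finS: "finite S" using finite_subset by blast
  assume "\<not> S \<subseteq> {1..card (vertices K)}"
  then obtain i where i: "i \<in> S" "v < i" "i \<in> {1..N}"
    using SN by (force simp: v_def V_def)
  define R where "R = S - {i}"
  have R: "finite R" "S = insert i R" "i \<notin> R" using i finS by (auto simp: R_def)
  let ?W = "wedge_of (generic_vec N \<alpha>)"
  let ?L = "\<lambda>y. restrict_ext K (?W R * y)"
  have below: "?L (generic_vec N \<alpha> l) \<in> span (face_vec N \<alpha> K ` lex_below N S)" if l: "l \<in> {1..v}" for l
  proof -
    have "restrict_ext K (?W (insert l R)) \<in> span (face_vec N \<alpha> K ` lex_below N S)" if "l \<notin> R"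
    proof -
      have "l \<in> insert l R - S" "insert l R \<inter> {..<l} = S \<inter> {..<l}"
        using i l that R by auto
      moreover have "card (insert l R) = card S" using R that by simp
      ultimately have "insert l R <\<^sub>L S" using lex_less_iff[of "insert l R" S] R(1) finS by auto
      then have "insert l R \<in> lex_below N S"
        using l v SN R \<open>card (insert l R) = card S\<close> by (auto simp: lex_below_def)
      then show ?thesis by (intro span_base) (auto simp: face_vec_def)
    qed
    then show ?thesis
      using generic_wedge_mult_cases[OF R(1), of N \<alpha> l]
      by (auto simp: linear_0[OF linear_restrict_ext] linear_neg[OF linear_restrict_ext] span_zero span_neg)
  qed
  have "generic_vec N \<alpha> i \<in> span (ext_gen ` {1..N})"
    unfolding generic_vec_def by (auto intro!: span_sum span_scale intro: span_base)
  then have "generic_vec N \<alpha> i \<in> span (generic_vec N \<alpha> ` {1..v} \<union> ext_gen ` ({1..N} - V))"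
    using generic_vecs_span[OF gen V] by (simp add: v_def)
  then have "?L (generic_vec N \<alpha> i) \<in> span (?L ` (generic_vec N \<alpha> ` {1..v} \<union> ext_gen ` ({1..N} - V)))"
    by (subst linear_span_image[OF linear_mult_restrict]) (rule imageI)
  also have "\<dots> \<subseteq> span (face_vec N \<alpha> K ` lex_below N S)"
    using below restrict_ext_mult_nonvertex[OF K]
    by (intro span_minimal) (auto simp: V_def span_zero)
  finally have "face_vec N \<alpha> K S \<in> span (face_vec N \<alpha> K ` lex_below N S)"
    using generic_wedge_mult_notin[OF R(1,3), of N \<alpha>] span_neg[of "restrict_ext K (- ?W S)"]
    unfolding face_vec_def R(2)[symmetric]
    by (auto simp: linear_neg[OF linear_restrict_ext])
  then show False using S by (simp add: in_algebraic_shifting_iff[OF K])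
qed

text \<open>Shifted sets lie in \<open>{1..v}\<close> with \<open>v\<close> the number of vertices,
  so membership is decided by two dimensions of families of subsets of \<open>{1..v}\<close>. Each
  such dimension is maximal at a generic matrix, and comparing the two matrices in both directions
  gives equality.\<close>

theorem algebraic_shifting_unique:
  assumes K: "abstract_simplicial_complex K"
    and adm: "admissible m \<alpha> K" "admissible p \<beta> K"
  shows "algebraic_shifting m \<alpha> K = algebraic_shifting p \<beta> K"
proof -
  define V where "V = vertices K"
  define v where "v = card V"
  have face: "T \<subseteq> V" if "T \<in> K" for T
    using face_subset_vertices[OF K that] by (simp add: V_def)
  have bound: "v \<le> m" if "admissible m \<alpha> K" for m \<alpha>
    using that card_mono[of "{1..m}" V] by (simp add: v_def V_def admissible_def)
  have span_eq: "span (face_vec m \<alpha> K ` lex_below m S) = span (face_vec m \<alpha> K ` lex_below v S)"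
    if adm: "admissible m \<alpha> K" and S: "S \<subseteq> {1..v}" for m \<alpha> S
  proof
    have Sm: "S \<subseteq> {1..m}" using bound[OF adm] S by force
    \<comment> \<open>Passing to shifted sets keeps the span and confines the row indices to
      \<open>{1..v}\<close>, a range independent of the size of the matrix.\<close>
    have "span (face_vec m \<alpha> K ` lex_below m S) =
        span (face_vec m \<alpha> K ` (lex_below m S \<inter> algebraic_shifting m \<alpha> K))"
      using lex_below_trans[OF Sm]
      by (intro span_shifting[OF K, symmetric, where k = "card S"]) (auto simp: lex_below_def)
    also have "\<dots> \<subseteq> span (face_vec m \<alpha> K ` lex_below v S)"
      using shifting_subset_vertices[OF K adm]
      by (intro span_mono image_mono) (auto simp: lex_below_def v_def V_def)
    finally show "span (face_vec m \<alpha> K ` lex_below m S) \<subseteq> span (face_vec m \<alpha> K ` lex_below v S)" .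
    show "span (face_vec m \<alpha> K ` lex_below v S) \<subseteq> span (face_vec m \<alpha> K ` lex_below m S)"
      using bound[OF adm] by (intro span_mono image_mono) (force simp: lex_below_def)
  qed
  have mem: "S \<in> algebraic_shifting m \<alpha> K \<longleftrightarrow> S \<subseteq> {1..v} \<and>
      dim (face_vec m \<alpha> K ` insert S (lex_below v S)) \<noteq> dim (face_vec m \<alpha> K ` lex_below v S)"
    if adm: "admissible m \<alpha> K" for m \<alpha> S
  proof (cases "S \<subseteq> {1..v}")
    case True
    then have "S \<subseteq> {1..m}" using bound[OF adm] by force
    then show ?thesis
      using True span_eq[OF adm True] lex_below_finite
      by (simp add: in_algebraic_shifting_iff[OF K] mem_span_iff_dim_insert)
  next
    case False
    then show ?thesis using shifting_subset_vertices[OF K adm] by (auto simp: v_def V_def)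
  qed
  have dim_le: "dim (face_vec p \<beta> K ` J) \<le> dim (face_vec m \<alpha> K ` J)"
    if adm: "admissible m \<alpha> K" "admissible p \<beta> K" and J: "J \<subseteq> Pow {1..v}" for m p \<alpha> \<beta> J
  proof -
    have "V \<subseteq> {1..m}" "V \<subseteq> {1..p}" using adm by (auto simp: admissible_def V_def)
    \<comment> \<open>All faces lie in both ranges of columns, so \<open>\<beta>\<close> may be read
      with the size of \<open>\<alpha>\<close>.\<close>
    then have "face_vec p \<beta> K ` J = face_vec m \<beta> K ` J"
      using face by (intro image_cong face_vec_cong) blast+
    moreover have "J \<subseteq> Pow {1..m}" using J bound[OF adm(1)] by force
    ultimately show ?thesis using dim_face_vec_generic_ge[OF K adm(1)] by simp
  qed
  have "dim (face_vec m \<alpha> K ` J) = dim (face_vec p \<beta> K ` J)" if "J \<subseteq> Pow {1..v}" for J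
    using dim_le[OF adm that] dim_le[OF adm(2,1) that] by (rule order_antisym[rotated])
  moreover have "insert S (lex_below v S) \<subseteq> Pow {1..v}" "lex_below v S \<subseteq> Pow {1..v}" if "S \<subseteq> {1..v}" for S
    using that by (auto simp: lex_below_def)
  ultimately show ?thesis
    unfolding set_eq_iff mem[OF adm(1)] mem[OF adm(2)] by (metis (no_types, lifting))
qed

section \<open>Disjoint unions\<close>

text \<open>For a family of sets of size \<open>j\<close>, this is its upper shadow in
  \<open>{1..N}\<close>.\<close>

definition supersets :: "nat \<Rightarrow> nat \<Rightarrow> nat set set \<Rightarrow> nat set set" where
  "supersets N j \<R> = {T. T \<subseteq> {1..N} \<and> card T = Suc j \<and> (\<exists>R\<in>\<R>. R \<subseteq> T)}"

text \<open>For each \<open>R\<close> both families span the image of the products of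
  \<open>f_R\<close> with all vectors, since the \<open>f_i\<close> and the \<open>e_c\<close> are
  bases of the same space; \<open>f_i\<close> with \<open>i \<in> R\<close> contributes 0. The
  exchange of bases involves every index \<open>i\<close>, which is why \<open>supersets\<close>
  adds elements at any position, not only above \<open>Max R\<close>.\<close>

lemma span_supersets:
  assumes gen: "generic_matrix N \<alpha>" and \<R>: "\<And>R. R \<in> \<R> \<Longrightarrow> R \<subseteq> {1..N} \<and> card R = j"
  shows "span (face_vec N \<alpha> K ` supersets N j \<R>) =
    span ((\<lambda>(R, c). restrict_ext K (wedge_of (generic_vec N \<alpha>) R * ext_gen c)) ` (\<R> \<times> {1..N}))"
    (is "span ?F = span ?E")
proof
  let ?W = "wedge_of (generic_vec N \<alpha>)"
  have fin: "finite R" if "R \<in> \<R>" for R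
    using \<R>[OF that] finite_subset by blast
  show "span ?F \<subseteq> span ?E"
  proof (rule span_minimal)
    show "?F \<subseteq> span ?E"
    proof
      fix x assume "x \<in> ?F"
      then obtain T R where T: "x = face_vec N \<alpha> K T" "T \<subseteq> {1..N}" "card T = Suc j" and R: "R \<in> \<R>" "R \<subseteq> T"
        by (auto simp: supersets_def)
      have "finite T" using T(2) finite_subset by blast
      then have "card (T - R) = 1" using R T(3) \<R>[OF R(1)] by (simp add: card_Diff_subset fin)
      then obtain i where "T - R = {i}" using card_1_singletonE by blast
      then have i: "i \<notin> R" "T = insert i R" using R(2) by auto
      have "restrict_ext K (?W R * ext_gen c) \<in> span ?E" if "c \<in> {1..N}" for c
        using that R(1) by (auto intro!: span_base)
      moreover have "restrict_ext K (?W R * generic_vec N \<alpha> i) =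
          (\<Sum>c=1..N. \<alpha> i c *\<^sub>R restrict_ext K (?W R * ext_gen c))"
        unfolding generic_vec_def
        by (simp add: linear_sum[OF linear_mult_restrict] linear_scale[OF linear_restrict_ext])
      ultimately have "restrict_ext K (?W R * generic_vec N \<alpha> i) \<in> span ?E"
        by (simp only:) (intro span_sum span_scale)
      then show "x \<in> span ?E"
        using generic_wedge_mult_notin[OF fin[OF R(1)] i(1), of N \<alpha>]
          span_neg[of "restrict_ext K (- ?W T)"]
        unfolding T(1) face_vec_def i(2)[symmetric]
        by (auto simp: linear_neg[OF linear_restrict_ext])
    qed
  qed simp
  show "span ?E \<subseteq> span ?F"
  proof (rule span_minimal)
    show "?E \<subseteq> span ?F"
    proof
      fix x assume "x \<in> ?E"
      then obtain R c where R: "R \<in> \<R>" and c: "c \<in> {1..N}" and x: "x = restrict_ext K (?W R * ext_gen c)"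
        by auto
      let ?L = "\<lambda>y. restrict_ext K (?W R * y)"
      have "?L (generic_vec N \<alpha> i) \<in> span ?F" if i: "i \<in> {1..N}" for i
      proof -
        have "restrict_ext K (?W (insert i R)) \<in> span ?F" if "i \<notin> R"
        proof -
          have "insert i R \<in> supersets N j \<R>"
            using R \<R>[OF R] fin[OF R] that i by (auto simp: supersets_def)
          then show ?thesis by (intro span_base) (auto simp: face_vec_def)
        qed
        then show ?thesis
          using generic_wedge_mult_cases[OF fin[OF R], of N \<alpha> i]
          by (auto simp: linear_0[OF linear_restrict_ext] linear_neg[OF linear_restrict_ext] span_zero span_neg)
      qed
      then have sub: "span (?L ` generic_vec N \<alpha> ` {1..N}) \<subseteq> span ?F"
        by (intro span_minimal) auto
      \<comment> \<open>The case \<open>V = {1..N}\<close> of \<open>generic_vecs_span\<close>: the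
        rows of the whole matrix span everything.\<close>
      have "ext_gen c \<in> span (generic_vec N \<alpha> ` {1..N})"
        using generic_vecs_span[OF gen subset_refl] c by (simp add: span_base)
      then have "?L (ext_gen c) \<in> span (?L ` generic_vec N \<alpha> ` {1..N})"
        by (subst linear_span_image[OF linear_mult_restrict]) (rule imageI)
      then show "x \<in> span ?F" using sub x by blast
    qed
  qed simp
qed

lemma vertices_Un: "vertices (K \<union> L) = vertices K \<union> vertices L"
  by (auto simp: vertices_def)

lemma abstract_simplicial_complex_Un:
  "abstract_simplicial_complex K \<Longrightarrow> abstract_simplicial_complex L \<Longrightarrow> abstract_simplicial_complex (K \<union> L)"
  unfolding abstract_simplicial_complex_def by (auto simp: ball_Un)

text \<open>Since \<open>V = span {e\<^sub>c | c \<in> K\<^sub>0} \<oplus> span {e\<^sub>c | c \<in> L\<^sub>0}\<close> modulo nonvertices, and wedging with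
  a vertex of one complex annihilates the other one, the space spanned by the sets above \<open>\<R>\<close> splits.\<close>

lemma dim_supersets_disjoint_Un:
  assumes K: "abstract_simplicial_complex K" and L: "abstract_simplicial_complex L"
    and disj: "vertices K \<inter> vertices L = {}"
    and gen: "generic_matrix N \<alpha>" and \<R>: "\<And>R. R \<in> \<R> \<Longrightarrow> R \<subseteq> {1..N} \<and> card R = j"
  shows "dim (face_vec N \<alpha> (K \<union> L) ` supersets N j \<R>) =
    dim (face_vec N \<alpha> K ` supersets N j \<R>) + dim (face_vec N \<alpha> L ` supersets N j \<R>)"
proof -
  let ?W = "wedge_of (generic_vec N \<alpha>)"
  define g where "g X = (\<lambda>(R, c). restrict_ext X (?W R * ext_gen c))" for X
  define E where "E X = g X ` (\<R> \<times> {1..N})" for X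
  have "finite \<R>" using \<R> by (intro finite_subset[of \<R> "Pow {1..N}"]) auto
  then have finE: "finite (E X)" for X by (simp add: E_def)
  have dimE: "dim (face_vec N \<alpha> X ` supersets N j \<R>) = dim (E X)" for X
    using span_supersets[OF gen \<R>, of \<R> X] unfolding E_def g_def by (intro span_eq_dim) blast
  \<comment> \<open>A common face has no vertices, whereas every term of the product contains
    \<open>c\<close>.\<close>
  have common: "coeff (?W R * ext_gen c) U = 0" if "U \<in> K" "U \<in> L" for U R c
  proof (rule ccontr)
    assume "coeff (?W R * ext_gen c) U \<noteq> 0"
    then obtain S where "coeff (ext_gen c) (U - S) \<noteq> 0" by (rule coeff_mult_nonzeroE)
    then have "c \<in> U" by (auto simp: coeff_ext_gen split: if_splits)
    then show False
      using that face_subset_vertices[OF K] face_subset_vertices[OF L] disj by blast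
  qed
  \<comment> \<open>The sum on the right counts common faces twice, but the coefficient there is
    0.\<close>
  have g_Un: "g (K \<union> L) z = g K z + g L z" for z
    unfolding g_def by (cases z) (auto intro!: exterior_eqI simp: common)
  have g_0: "g K z = 0 \<or> g L z = 0" for z
    using restrict_ext_mult_nonvertex[OF K] restrict_ext_mult_nonvertex[OF L] disj
    unfolding g_def by (cases z) (simp, blast)
  have "span (E (K \<union> L)) = span (E K \<union> E L)"
  proof
    have "g (K \<union> L) z \<in> span (E K \<union> E L)" if "z \<in> \<R> \<times> {1..N}" for z
      unfolding g_Un E_def using that by (intro span_add span_base) blast+
    then show "span (E (K \<union> L)) \<subseteq> span (E K \<union> E L)"
      by (intro span_minimal) (auto simp: E_def simp del: mem_Sigma_iff)
    \<comment> \<open>One of the two vectors is 0, so the vector of the union equals the other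
      one.\<close>
    have "g K z \<in> span (E (K \<union> L)) \<and> g L z \<in> span (E (K \<union> L))" if "z \<in> \<R> \<times> {1..N}" for z
    proof -
      have "g (K \<union> L) z \<in> span (E (K \<union> L))" using that by (auto simp: E_def intro!: span_base)
      then show ?thesis using g_0[of z] by (auto simp: g_Un span_zero)
    qed
    then show "span (E K \<union> E L) \<subseteq> span (E (K \<union> L))"
      by (intro span_minimal) (auto simp: E_def simp del: mem_Sigma_iff)
  qed
  then have "dim (E (K \<union> L)) = dim (E K \<union> E L)" by (rule span_eq_dim)
  also have "\<dots> = dim (E K) + dim (E L)"
  proof (rule dim_Un_projections[OF linear_restrict_ext[of K]])
    show "restrict_ext K x = x" if "x \<in> E K" for x
      using that by (auto simp: E_def g_def intro!: exterior_eqI)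
    show "restrict_ext K x = 0" if "x \<in> E L" for x
      using that by (auto simp: E_def g_def common intro!: exterior_eqI)
  qed (rule finE)+
  finally show ?thesis by (simp add: dimE)
qed

section \<open>Sets with a given initial part\<close>

text \<open>For nonempty \<open>A\<close> these tops correspond to the shifted sets in
  \<open>I^1_A\<close>. The range ends at the size \<open>N\<close> of the matrix so that
  \<open>K\<close>, \<open>L\<close> and their union can share it.\<close>

definition shifted_tops ::
  "nat \<Rightarrow> nat set \<Rightarrow> (nat \<Rightarrow> nat \<Rightarrow> real) \<Rightarrow> nat set set \<Rightarrow> nat set" where
  "shifted_tops N A \<alpha> K = {t \<in> {Max A<..N}. insert t A \<in> algebraic_shifting N \<alpha> K}"

context
  fixes N :: nat and A :: "nat set"
  assumes A: "A \<subseteq> {1..N}" "A \<noteq> {}"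
begin

lemma finite_base: "finite A"
  using A(1) finite_subset by blast

text \<open>The bound \<open>x < Max A\<close> separates these sets from the extensions of
  \<open>A\<close> at the top. If \<open>R\<close> precedes \<open>A\<close> and
  \<open>T = R \<union> {i}\<close>, the first disagreement of \<open>T\<close> with
  \<open>A\<close> is the smaller of \<open>i\<close> and that of \<open>R\<close>; conversely,
  deleting \<open>Max T\<close> leaves a predecessor of \<open>A\<close>.\<close>

lemma mem_supersets_below_iff:
  "T \<in> supersets N (card A) (lex_below N A) \<longleftrightarrow> T \<subseteq> {1..N} \<and> card T = Suc (card A) \<and>
    (\<exists>x\<in>T - A. x < Max A \<and> (\<forall>w<x. w \<in> T \<longleftrightarrow> w \<in> A))"
proof
  assume "T \<in> supersets N (card A) (lex_below N A)"
  then obtain R where T: "T \<subseteq> {1..N}" "card T = Suc (card A)" and R: "R \<subseteq> T" "R \<subseteq> {1..N}" "card R = card A" "R <\<^sub>L A"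
    by (auto simp: supersets_def lex_below_def)
  have fin: "finite R" "finite T" using R(2) T(1) finite_subset by blast+
  obtain x where x: "x \<in> R - A" "R \<inter> {..<x} = A \<inter> {..<x}"
    using lex_less_iff[OF fin(1) finite_base] R(4) by blast
  have agree: "w \<in> R \<longleftrightarrow> w \<in> A" if "w < x" for w
    using x(2) that by (metis Int_iff lessThan_iff)
  \<comment> \<open>Equal sizes force an element of \<open>A\<close> outside \<open>R\<close>; it
    lies above \<open>x\<close>, which bounds \<open>x\<close> by \<open>Max A\<close>.\<close>
  have "\<not> A \<subseteq> R" using x(1) card_subset_eq[OF fin(1) _ R(3)[symmetric]] by auto
  then obtain y where y: "y \<in> A" "y \<notin> R" by blast
  then have "x < y" using agree[of y] x(1) by (metis DiffD1 nat_neq_iff)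
  moreover have "y \<le> Max A" using y(1) finite_base by simp
  ultimately have xM: "x < Max A" by simp
  have "card (T - R) = 1" using R T(2) fin by (simp add: card_Diff_subset)
  then obtain i where "T - R = {i}" using card_1_singletonE by blast
  then have i: "i \<notin> R" "T = insert i R" using R(1) by auto
  have ex: "\<exists>x\<in>T - A. x < Max A \<and> (\<forall>w<x. w \<in> T \<longleftrightarrow> w \<in> A)"
  proof (cases "i < x")
    case True
    then show ?thesis
      using i agree xM by (intro bexI[of _ i]) auto
  next
    case False
    then show ?thesis
      using i agree xM x(1) by (intro bexI[of _ x]) auto
  qed
  show "T \<subseteq> {1..N} \<and> card T = Suc (card A) \<and> (\<exists>x\<in>T - A. x < Max A \<and> (\<forall>w<x. w \<in> T \<longleftrightarrow> w \<in> A))"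
    by (intro conjI T ex)
next
  assume *: "T \<subseteq> {1..N} \<and> card T = Suc (card A) \<and> (\<exists>x\<in>T - A. x < Max A \<and> (\<forall>w<x. w \<in> T \<longleftrightarrow> w \<in> A))"
  then have T: "T \<subseteq> {1..N}" "card T = Suc (card A)" by simp_all
  from * obtain x where x: "x \<in> T - A" "x < Max A" and agree: "\<And>w. w < x \<Longrightarrow> w \<in> T \<longleftrightarrow> w \<in> A"
    by (elim conjE bexE) simp
  have fin: "finite T" using T(1) finite_subset by blast
  have ne: "T \<noteq> {}" using T(2) by auto
  \<comment> \<open>Otherwise \<open>T\<close> would be too small: below \<open>x\<close> it agrees
    with \<open>A\<close>, and \<open>Max A\<close> lies above \<open>x\<close>.\<close>
  have "x \<noteq> Max T"
  proof
    assume "x = Max T"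
    have "T \<subseteq> insert x (A - {Max A})"
    proof
      fix w assume "w \<in> T"
      show "w \<in> insert x (A - {Max A})"
      proof (cases "w = x")
        case False
        then have "w < x" using Max_ge[OF fin \<open>w \<in> T\<close>] \<open>x = Max T\<close> by simp
        then show ?thesis using agree[of w] \<open>w \<in> T\<close> x(2) by simp
      qed simp
    qed
    then have "card T \<le> card (insert x (A - {Max A}))"
      using finite_base by (intro card_mono) auto
    also have "\<dots> = card A"
      using x(1) finite_base A(2) card_gt_0_iff[of A] by (simp add: card_Diff_singleton Max_in)
    finally show False using T(2) by simp
  qed
  then have xm: "x < Max T" using x(1) fin by (simp add: order.strict_iff_order)
  define R where "R = T - {Max T}"
  have "R \<subseteq> {1..N}" "finite R" "R \<subseteq> T" using T(1) fin by (auto simp: R_def)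
  moreover have "card R = card A"
    using T(2) fin ne by (simp add: R_def card_Diff_singleton Max_in)
  moreover have "x \<in> R - A" "R \<inter> {..<x} = A \<inter> {..<x}"
    using x(1) xm agree by (auto simp: R_def)
  ultimately have "R \<in> lex_below N A" "R \<subseteq> T"
    using lex_less_iff[of R A] finite_base by (auto simp: lex_below_def)
  then show "T \<in> supersets N (card A) (lex_below N A)"
    using T by (auto simp: supersets_def)
qed

lemma supersets_belowE:
  assumes "T \<in> supersets N (card A) (lex_below N A)"
  obtains x where "T \<subseteq> {1..N}" "card T = Suc (card A)" "x \<in> T - A" "x < Max A"
    "\<forall>w<x. w \<in> T \<longleftrightarrow> w \<in> A"
  using assms unfolding mem_supersets_below_iff by (elim conjE bexE)

lemma supersets_belowI:
  assumes "T \<subseteq> {1..N}" "card T = Suc (card A)" "x \<in> T - A" "x < Max A"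
    "\<And>w. w < x \<Longrightarrow> w \<in> T \<longleftrightarrow> w \<in> A"
  shows "T \<in> supersets N (card A) (lex_below N A)"
  using assms unfolding mem_supersets_below_iff by (intro conjI bexI[of _ x] allI impI)

text \<open>The first disagreement of \<open>T\<close> with \<open>A\<close> is the smaller of those
  between \<open>T\<close> and \<open>S\<close> and between \<open>S\<close> and \<open>A\<close>,
  hence still below \<open>Max A\<close>.\<close>

lemma lex_below_supersets_below:
  assumes "S \<in> supersets N (card A) (lex_below N A)"
  shows "lex_below N S \<subseteq> supersets N (card A) (lex_below N A)"
proof
  fix T assume T: "T \<in> lex_below N S"
  have S: "S \<subseteq> {1..N}" "card S = Suc (card A)"
    using assms by (auto simp: supersets_def)
  have TN: "T \<subseteq> {1..N}" "card T = Suc (card A)" "T <\<^sub>L S"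
    using T S(2) by (auto simp: lex_below_def)
  have "finite S" "finite T" using S TN finite_subset by blast+
  then obtain y where y: "y \<in> T - S" "T \<inter> {..<y} = S \<inter> {..<y}"
    using TN(3) lex_less_iff by blast
  have agree: "w \<in> T \<longleftrightarrow> w \<in> S" if "w < y" for w
    using y(2) that by (metis Int_iff lessThan_iff)
  obtain x where "S \<subseteq> {1..N}" "card S = Suc (card A)" and x: "x \<in> S - A" "x < Max A"
    and agree': "\<forall>w<x. w \<in> S \<longleftrightarrow> w \<in> A"
    using assms by (rule supersets_belowE)
  have "x \<noteq> y" using x y by blast
  then consider "x < y" | "y < x" by linarith
  then show "T \<in> supersets N (card A) (lex_below N A)"
  proof cases
    case 1
    then show ?thesis using TN agree agree' x by (intro supersets_belowI[of T x]) auto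
  next
    case 2
    then show ?thesis using TN agree agree' x y(1) by (intro supersets_belowI[of T y]) auto
  qed
qed

text \<open>A predecessor of \<open>A \<union> {t}\<close> first deviates from it either below or
  above \<open>Max A\<close>. In the second case it contains all of \<open>A\<close>, and its size
  leaves room for a single further element, which must be less than \<open>t\<close>.\<close>

lemma lex_below_insert_eq:
  assumes t: "Max A < t" "t \<le> N"
  shows "lex_below N (insert t A) =
    supersets N (card A) (lex_below N A) \<union> (\<lambda>i. insert i A) ` {Max A<..<t}"
proof (intro equalityI subsetI)
  have AM: "w \<le> Max A" if "w \<in> A" for w using that finite_base by simp
  have tA: "t \<notin> A" using AM t by force
  fix T assume T: "T \<in> lex_below N (insert t A)"
  then have TN: "T \<subseteq> {1..N}" "card T = Suc (card A)" "T <\<^sub>L insert t A"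
    using tA finite_base by (auto simp: lex_below_def)
  have fin: "finite T" using TN(1) finite_subset by blast
  then obtain x where x: "x \<in> T - insert t A" "T \<inter> {..<x} = insert t A \<inter> {..<x}"
    using TN(3) lex_less_iff[of T "insert t A"] finite_base by auto
  have agree: "w \<in> T \<longleftrightarrow> w = t \<or> w \<in> A" if "w < x" for w
    using x(2) that by (metis Int_iff insert_iff lessThan_iff)
  consider "x < Max A" | "Max A < x"
    using x(1) Max_in[OF finite_base A(2)] by (cases "x = Max A") (auto simp: neq_iff)
  then show "T \<in> supersets N (card A) (lex_below N A) \<union> (\<lambda>i. insert i A) ` {Max A<..<t}"
  proof cases
    case 1
    then have "w \<in> T \<longleftrightarrow> w \<in> A" if "w < x" for w using agree[OF that] that t by auto
    then show ?thesis using 1 x(1) TN by (intro UnI1 supersets_belowI[of T x]) auto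
  next
    case 2
    have sub: "insert x A \<subseteq> T" using agree AM 2 x(1) by fastforce
    have "card (insert x A) = Suc (card A)" using x(1) finite_base by simp
    then have T: "T = insert x A" using sub card_subset_eq[OF fin sub] TN(2) by simp
    then have "t \<notin> T" using x(1) tA by auto
    then have "\<not> t < x" using agree by blast
    then show ?thesis using T 2 x(1) by auto
  qed
next
  have AM: "w \<le> Max A" if "w \<in> A" for w using that finite_base by simp
  have tA: "t \<notin> A" using AM t by force
  fix T assume "T \<in> supersets N (card A) (lex_below N A) \<union> (\<lambda>i. insert i A) ` {Max A<..<t}"
  then consider "T \<in> supersets N (card A) (lex_below N A)" | i where "T = insert i A" "Max A < i" "i < t"
    by auto
  then have "T \<subseteq> {1..N} \<and> card T = Suc (card A) \<and> (\<exists>x\<in>T - insert t A. T \<inter> {..<x} = insert t A \<inter> {..<x})"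
  proof cases
    case 1
    then obtain x where "T \<subseteq> {1..N}" "card T = Suc (card A)" "x \<in> T - A" "x < Max A"
      "\<forall>w<x. w \<in> T \<longleftrightarrow> w \<in> A"
      by (rule supersets_belowE)
    then show ?thesis using t by (intro conjI bexI[of _ x]) auto
  next
    case 2
    have "i \<notin> A" using AM 2 by force
    then show ?thesis using 2 t A finite_base by (intro conjI bexI[of _ i]) auto
  qed
  moreover from this have "finite T" using finite_subset by blast
  ultimately show "T \<in> lex_below N (insert t A)"
    using lex_less_iff[of T "insert t A"] tA finite_base by (auto simp: lex_below_def)
qed

text \<open>Adding to \<open>A\<close> an element below \<open>Max A\<close> gives a set already in
  the lower family, so only extensions at the top are new.\<close>

lemma supersets_atMost_eq:
  "supersets N (card A) (insert A (lex_below N A)) =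
    supersets N (card A) (lex_below N A) \<union> (\<lambda>i. insert i A) ` {Max A<..N}"
proof (intro equalityI subsetI)
  fix T assume T: "T \<in> supersets N (card A) (insert A (lex_below N A))"
  show "T \<in> supersets N (card A) (lex_below N A) \<union> (\<lambda>i. insert i A) ` {Max A<..N}"
  proof (cases "A \<subseteq> T")
    case True
    have TN: "T \<subseteq> {1..N}" "card T = Suc (card A)" using T by (auto simp: supersets_def)
    have "finite T" using TN(1) finite_subset by blast
    then have "card (T - A) = 1" using True TN(2) finite_base by (simp add: card_Diff_subset)
    then obtain i where "T - A = {i}" using card_1_singletonE by blast
    then have i: "i \<notin> A" "T = insert i A" using True by auto
    show ?thesis
    proof (cases "i < Max A")
      case True
      then show ?thesis using TN i by (intro UnI1 supersets_belowI[of T i]) auto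
    next
      case False
      then have "Max A < i" using i(1) Max_in[OF finite_base A(2)] by (cases "i = Max A") auto
      then show ?thesis using i TN(1) by auto
    qed
  next
    case False
    then show ?thesis using T by (auto simp: supersets_def)
  qed
next
  have AM: "w \<le> Max A" if "w \<in> A" for w using that finite_base by simp
  fix T assume "T \<in> supersets N (card A) (lex_below N A) \<union> (\<lambda>i. insert i A) ` {Max A<..N}"
  then consider "T \<in> supersets N (card A) (lex_below N A)" | i where "T = insert i A" "Max A < i" "i \<le> N"
    by auto
  then show "T \<in> supersets N (card A) (insert A (lex_below N A))"
  proof cases
    case 1
    then show ?thesis by (auto simp: supersets_def)
  next
    case 2
    have "i \<notin> A" using AM 2 by force
    then show ?thesis using 2 A finite_base by (auto simp: supersets_def)
  qed
qed

lemma insert_notin_supersets_below: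
  assumes "Max A < t"
  shows "insert t A \<notin> supersets N (card A) (lex_below N A)"
  by (rule notI, erule supersets_belowE) (use assms in \<open>auto dest: order.asym\<close>)

lemma inj_on_insert_above: "inj_on (\<lambda>i. insert i A) {i. Max A < i}"
proof (rule inj_onI)
  fix i k assume "i \<in> {i. Max A < i}" "k \<in> {i. Max A < i}" "insert i A = insert k A"
  moreover from this have "i \<notin> A" using Max_ge[OF finite_base, of i] by auto
  ultimately show "i = k" by blast
qed

lemma dim_supersets_atMost:
  assumes K: "abstract_simplicial_complex K"
  shows "dim (face_vec N \<alpha> K ` supersets N (card A) (insert A (lex_below N A))) =
    dim (face_vec N \<alpha> K ` supersets N (card A) (lex_below N A)) + card (shifted_tops N A \<alpha> K)"
proof -
  let ?B = "supersets N (card A) (lex_below N A)"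
  let ?C = "supersets N (card A) (insert A (lex_below N A))"
  let ?D = "algebraic_shifting N \<alpha> K"
  have "dim (face_vec N \<alpha> K ` ?B) = card (?B \<inter> ?D)"
    using lex_below_supersets_below
    by (intro dim_eq_card_shifting[OF K, where k = "Suc (card A)"]) (auto simp: supersets_def)
  moreover have "dim (face_vec N \<alpha> K ` ?C) = card (?C \<inter> ?D)"
  proof (rule dim_eq_card_shifting[OF K, where k = "Suc (card A)"])
    fix S assume "S \<in> ?C"
    then consider "S \<in> ?B" | t where "S = insert t A" "Max A < t" "t \<le> N"
      unfolding supersets_atMost_eq by auto
    then show "lex_below N S \<subseteq> ?C"
      unfolding supersets_atMost_eq
      by cases (use lex_below_supersets_below lex_below_insert_eq in auto)
  qed (auto simp: supersets_def)
  moreover have "?C \<inter> ?D = (?B \<inter> ?D) \<union> (\<lambda>i. insert i A) ` shifted_tops N A \<alpha> K"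
    unfolding supersets_atMost_eq shifted_tops_def by auto
  moreover have "finite ?B" by (rule finite_subset[of _ "Pow {1..N}"]) (auto simp: supersets_def)
  moreover have "finite (shifted_tops N A \<alpha> K)" by (simp add: shifted_tops_def)
  moreover have "(?B \<inter> ?D) \<inter> (\<lambda>i. insert i A) ` shifted_tops N A \<alpha> K = {}"
    using insert_notin_supersets_below by (auto simp: shifted_tops_def)
  moreover have "card ((\<lambda>i. insert i A) ` shifted_tops N A \<alpha> K) = card (shifted_tops N A \<alpha> K)"
    by (intro card_image inj_on_subset[OF inj_on_insert_above]) (auto simp: shifted_tops_def)
  ultimately show ?thesis by (simp add: card_Un_disjoint)
qed

lemma card_shifted_tops_disjoint_Un:
  assumes K: "abstract_simplicial_complex K" and L: "abstract_simplicial_complex L"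
    and disj: "vertices K \<inter> vertices L = {}" and gen: "generic_matrix N \<alpha>"
  shows "card (shifted_tops N A \<alpha> (K \<union> L)) = card (shifted_tops N A \<alpha> K) + card (shifted_tops N A \<alpha> L)"
proof -
  have "R \<subseteq> {1..N} \<and> card R = card A" if "R \<in> insert A (lex_below N A)" for R
    using that A by (auto simp: lex_below_def)
  then have "dim (face_vec N \<alpha> (K \<union> L) ` supersets N (card A) \<R>) =
      dim (face_vec N \<alpha> K ` supersets N (card A) \<R>) + dim (face_vec N \<alpha> L ` supersets N (card A) \<R>)"
    if "\<R> \<subseteq> insert A (lex_below N A)" for \<R>
    using that by (intro dim_supersets_disjoint_Un[OF K L disj gen]) blast
  \<comment> \<open>Both dimensions are additive; subtracting them leaves the numbers of
    tops.\<close>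
  from this[OF subset_refl] this[OF subset_insertI] show ?thesis
    by (simp add: dim_supersets_atMost K L abstract_simplicial_complex_Un)
qed

text \<open>Exchanging the rows \<open>t\<close> and \<open>t'\<close> of a generic matrix cannot increase the rank of the rows up to
  \<open>A \<union> {t'}\<close>, and it fixes the span of the rows below \<open>A\<close>.\<close>

lemma shifted_tops_down:
  assumes K: "abstract_simplicial_complex K" and adm: "admissible N \<alpha> K"
    and t: "t \<in> shifted_tops N A \<alpha> K" and t': "Max A < t'" "t' < t"
  shows "t' \<in> shifted_tops N A \<alpha> K"
proof (rule ccontr)
  have tN: "Max A < t" "t \<le> N" "insert t A \<in> algebraic_shifting N \<alpha> K"
    using t by (auto simp: shifted_tops_def)
  assume "t' \<notin> shifted_tops N A \<alpha> K"
  then have notin: "insert t' A \<notin> algebraic_shifting N \<alpha> K"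
    using t' tN by (simp add: shifted_tops_def)
  have AM: "w \<le> Max A" if "w \<in> A" for w using that finite_base by simp
  let ?S = "insert t' A"
  let ?B = "lex_below N ?S"
  have subN: "?S \<subseteq> {1..N}" "insert t A \<subseteq> {1..N}" using t' tN A by auto
  define \<pi> where "\<pi> i = (if i = t then t' else if i = t' then t else i)" for i
  \<comment> \<open>\<open>\<alpha>\<close> with rows \<open>t\<close> and \<open>t'\<close>
    exchanged, the comparison matrix for the rank inequality.\<close>
  define \<beta> where "\<beta> i = \<alpha> (\<pi> i)" for i
  have \<pi>: "\<pi> (\<pi> i) = i" for i by (simp add: \<pi>_def)
  then have inj: "inj_on \<pi> X" for X by (metis inj_onI)
  have \<pi>A: "\<pi> w = w" if "w \<le> Max A" for w using that t' by (auto simp: \<pi>_def)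
  have \<pi>AA: "\<pi> ` A = A" using \<pi>A AM by simp
  have \<pi>N: "\<pi> ` T \<subseteq> {1..N}" if "T \<subseteq> {1..N}" for T
    using that subN by (auto simp: \<pi>_def)
  have gv: "generic_vec N \<beta> = generic_vec N \<alpha> \<circ> \<pi>"
    by (rule ext) (simp add: generic_vec_def \<beta>_def)
  have in_span: "face_vec N \<alpha> K (\<pi> ` T) \<in> span (face_vec N \<beta> K ` insert ?S ?B)" if T: "T \<in> insert ?S ?B" for T
  proof -
    have "finite T" using T finite_base finite_subset[OF _ finite_atLeastAtMost[of 1 N]] by (auto simp: lex_below_def)
    then have "face_vec N \<alpha> K (\<pi> ` T) = face_vec N \<beta> K T \<or> face_vec N \<alpha> K (\<pi> ` T) = - face_vec N \<beta> K T"
      using generic_wedge_comp[of T \<pi> N \<alpha>, OF _ inj] linear_neg[OF linear_restrict_ext]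
      unfolding face_vec_def gv by (metis minus_equation_iff)
    moreover have "face_vec N \<beta> K T \<in> span (face_vec N \<beta> K ` insert ?S ?B)"
      using T by (intro span_base) auto
    ultimately show ?thesis using span_neg by fastforce
  qed
  have B_sub: "face_vec N \<alpha> K T \<in> span (face_vec N \<beta> K ` insert ?S ?B)" if T: "T \<in> ?B" for T
  proof -
    \<comment> \<open>\<open>\<pi>\<close> maps the predecessors of \<open>A \<union> {t'}\<close>
      to such predecessors: it fixes everything up to \<open>Max A\<close>, hence a first deviation
      there, and it fixes the sets \<open>A \<union> {i}\<close> with \<open>i < t'\<close>.\<close>
    have "\<pi> ` T \<in> ?B"
    proof -
      consider "T \<in> supersets N (card A) (lex_below N A)" | i where "T = insert i A" "Max A < i" "i < t'"
        using T lex_below_insert_eq[of t'] t' tN by auto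
      then have "\<pi> ` T \<in> supersets N (card A) (lex_below N A) \<union> (\<lambda>i. insert i A) ` {Max A<..<t'}"
      proof cases
        case 1
        then obtain x where x: "T \<subseteq> {1..N}" "card T = Suc (card A)" "x \<in> T - A" "x < Max A"
          "\<forall>w<x. w \<in> T \<longleftrightarrow> w \<in> A"
          by (rule supersets_belowE)
        have same: "w \<in> \<pi> ` T \<longleftrightarrow> w \<in> T" if "w \<le> Max A" for w
          using \<pi>A[OF that] \<pi> by (metis image_iff)
        have "card (\<pi> ` T) = Suc (card A)" using x(2) by (simp add: card_image inj)
        moreover have "x \<in> \<pi> ` T - A" using same[of x] x(3,4) by auto
        moreover have "w \<in> \<pi> ` T \<longleftrightarrow> w \<in> A" if "w < x" for w
          using same[of w] x(4) x(5) that by simp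
        ultimately show ?thesis
          using \<pi>N[OF x(1)] x(4) by (intro UnI1 supersets_belowI)
      next
        case 2
        then have "\<pi> i = i" using t' by (simp add: \<pi>_def)
        then show ?thesis using 2 \<pi>AA by auto
      qed
      then show ?thesis using lex_below_insert_eq[of t'] t' tN by simp
    qed
    then have "face_vec N \<alpha> K (\<pi> ` \<pi> ` T) \<in> span (face_vec N \<beta> K ` insert ?S ?B)"
      by (intro in_span) blast
    then show ?thesis by (simp add: image_image \<pi>)
  qed
  have "\<pi> ` ?S = insert t A" using t' by (simp only: image_insert \<pi>AA) (simp add: \<pi>_def)
  then have "face_vec N \<alpha> K (insert t A) \<in> span (face_vec N \<beta> K ` insert ?S ?B)"
    using in_span[of ?S] by simp
  \<comment> \<open>Under \<open>\<alpha>\<close>, the predecessors of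
    \<open>A \<union> {t'}\<close> together with \<open>A \<union> {t}\<close> have at most the rank
    obtained with \<open>A \<union> {t'}\<close> instead. That is the rank of the predecessors
    alone, as \<open>A \<union> {t'}\<close> is not shifted; so \<open>A \<union> {t}\<close>
    contributes nothing new either.\<close>
  then have "dim (face_vec N \<alpha> K ` insert (insert t A) ?B) \<le> dim (face_vec N \<beta> K ` insert ?S ?B)"
    using B_sub lex_below_finite by (intro dim_span_mono) auto
  also have "\<dots> \<le> dim (face_vec N \<alpha> K ` insert ?S ?B)"
    using subN by (intro dim_face_vec_generic_ge[OF K adm]) (auto simp: lex_below_def)
  also have "\<dots> = dim (face_vec N \<alpha> K ` ?B)"
    using notin subN lex_below_finite
    by (simp add: in_algebraic_shifting_iff[OF K] mem_span_iff_dim_insert)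
  finally have le: "dim (face_vec N \<alpha> K ` insert (insert t A) ?B) \<le> dim (face_vec N \<alpha> K ` ?B)" .
  have "dim (face_vec N \<alpha> K ` ?B) \<le> dim (face_vec N \<alpha> K ` insert (insert t A) ?B)"
    using lex_below_finite by (intro dim_span_mono) (auto intro: span_base)
  then have "face_vec N \<alpha> K (insert t A) \<in> span (face_vec N \<alpha> K ` ?B)"
    using le lex_below_finite by (simp add: mem_span_iff_dim_insert)
  moreover have "?B \<subseteq> lex_below N (insert t A)"
    using t' tN by (auto simp: lex_below_insert_eq)
  ultimately have "face_vec N \<alpha> K (insert t A) \<in> span (face_vec N \<alpha> K ` lex_below N (insert t A))"
    using span_mono[OF image_mono] by blast
  then show False using tN(3) by (simp add: in_algebraic_shifting_iff[OF K])
qed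

text \<open>By \<open>shifted_tops_down\<close> the tops fill an interval starting right after
  \<open>Max A\<close>, so \<open>t\<close> is a top exactly when its distance from
  \<open>Max A\<close> is at most their number.\<close>

lemma mem_shifted_tops_iff:
  assumes K: "abstract_simplicial_complex K" and adm: "admissible N \<alpha> K"
    and t: "Max A < t" "t \<le> N"
  shows "insert t A \<in> algebraic_shifting N \<alpha> K \<longleftrightarrow> t - Max A \<le> card (shifted_tops N A \<alpha> K)"
proof
  have fin: "finite (shifted_tops N A \<alpha> K)" by (simp add: shifted_tops_def)
  assume "insert t A \<in> algebraic_shifting N \<alpha> K"
  then have "t \<in> shifted_tops N A \<alpha> K" using t by (simp add: shifted_tops_def)
  then have "{Max A<..t} \<subseteq> shifted_tops N A \<alpha> K"
    using shifted_tops_down[OF K adm] by (force simp: le_less)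
  then show "t - Max A \<le> card (shifted_tops N A \<alpha> K)"
    using card_mono[OF fin, of "{Max A<..t}"] by simp
next
  assume le: "t - Max A \<le> card (shifted_tops N A \<alpha> K)"
  show "insert t A \<in> algebraic_shifting N \<alpha> K"
  proof (rule ccontr)
    assume "insert t A \<notin> algebraic_shifting N \<alpha> K"
    then have "t \<notin> shifted_tops N A \<alpha> K" by (simp add: shifted_tops_def)
    then have "i < t" if "i \<in> shifted_tops N A \<alpha> K" for i
      using shifted_tops_down[OF K adm that t(1)] that by (metis linorder_neqE_nat)
    then have "shifted_tops N A \<alpha> K \<subseteq> {Max A<..<t}" by (auto simp: shifted_tops_def)
    then have "card (shifted_tops N A \<alpha> K) \<le> card {Max A<..<t}" by (intro card_mono) auto
    then show False using le t by simp
  qed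
qed

end

section \<open>Initial parts, one-element extensions and the final count\<close>

lemma sorted_list_of_set_insert_last:
  assumes "finite A" "\<And>w. w \<in> A \<Longrightarrow> w < t"
  shows "sorted_list_of_set (insert t A) = sorted_list_of_set A @ [t]"
proof -
  have "sorted_list_of_set (set (sorted_list_of_set A @ [t])) = sorted_list_of_set A @ [t]"
    using assms by (intro sorted_list_of_set.idem_if_sorted_distinct) (auto simp: sorted_append less_imp_le)
  then show ?thesis using assms by simp
qed

lemma one_extensions_eq:
  assumes A: "A \<subseteq> {1..n}" "A \<noteq> {}"
  shows "one_extensions n A = (\<lambda>t. insert t A) ` {Max A<..n}"
proof (intro equalityI subsetI)
  have fin: "finite A" using A(1) finite_subset by blast
  fix T assume "T \<in> one_extensions n A"
  then have T: "T \<subseteq> {1..n}" "card T = card A + 1" "set (take (card A) (sorted_list_of_set T)) = A"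
    by (auto simp: one_extensions_def init_def)
  have finT: "finite T" using T(1) finite_subset by blast
  have "length (sorted_list_of_set T) = Suc (card A)" using T(2) by simp
  then obtain ys t where ys: "sorted_list_of_set T = ys @ [t]" "length ys = card A"
    by (metis length_Suc_conv_rev)
  have "set ys = A" using T(3) ys by simp
  moreover have "sorted_wrt (<) (ys @ [t])"
    using ys(1) strict_sorted_list_of_set[of T] by simp
  ultimately have "Max A < t" using fin A(2) by (auto simp: sorted_wrt_append)
  moreover have "T = insert t A"
    using arg_cong[OF ys(1), of set] finT \<open>set ys = A\<close> by simp
  ultimately show "T \<in> (\<lambda>t. insert t A) ` {Max A<..n}"
    using T(1) by auto
next
  have fin: "finite A" using A(1) finite_subset by blast
  fix T assume "T \<in> (\<lambda>t. insert t A) ` {Max A<..n}"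
  then obtain t where t: "T = insert t A" "Max A < t" "t \<le> n" by auto
  have lt: "w < t" if "w \<in> A" for w using that t(2) fin by (meson Max_ge le_less_trans)
  have "t \<notin> A" using lt by blast
  have sorted: "sorted_list_of_set (insert t A) = sorted_list_of_set A @ [t]"
    using fin lt by (rule sorted_list_of_set_insert_last)
  have "init (card A) T = A"
    unfolding init_def t(1) sorted using fin by simp
  then show "T \<in> one_extensions n A"
    using t A fin \<open>t \<notin> A\<close> by (auto simp: one_extensions_def)
qed

text \<open>The extensions are cut off at \<open>n\<close> and the tops at \<open>m\<close>. The two
  ranges give the same sets because entries of shifted sets are at most the number of vertices,
  which is at most \<open>n\<close>.\<close>

lemma card_one_extensions_shifting:
  assumes K: "abstract_simplicial_complex K" and adm: "admissible m \<alpha> K"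
    and A: "A \<subseteq> {1..n}" "A \<noteq> {}" and "n \<le> m" "vertices K \<subseteq> {1..n}"
  shows "card (one_extensions n A \<inter> algebraic_shifting m \<alpha> K) = card (shifted_tops m A \<alpha> K)"
proof -
  have Am: "A \<subseteq> {1..m}" using A(1) assms(5) by force
  have "card (vertices K) \<le> n" using card_mono[OF _ assms(6)] by simp
  then have top: "t \<le> n" if "insert t A \<in> algebraic_shifting m \<alpha> K" for t
    using shifting_subset_vertices[OF K adm that] by auto
  have "one_extensions n A \<inter> algebraic_shifting m \<alpha> K =
      (\<lambda>t. insert t A) ` {t \<in> {Max A<..n}. insert t A \<in> algebraic_shifting m \<alpha> K}"
    unfolding one_extensions_eq[OF A] by blast
  also have "{t \<in> {Max A<..n}. insert t A \<in> algebraic_shifting m \<alpha> K} = shifted_tops m A \<alpha> K"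
    unfolding shifted_tops_def using assms(5) by (auto dest: top)
  finally have "one_extensions n A \<inter> algebraic_shifting m \<alpha> K = (\<lambda>t. insert t A) ` shifted_tops m A \<alpha> K" .
  moreover have "inj_on (\<lambda>t. insert t A) (shifted_tops m A \<alpha> K)"
    by (intro inj_on_subset[OF inj_on_insert_above[OF Am A(2)]]) (auto simp: shifted_tops_def)
  ultimately show ?thesis by (simp add: card_image)
qed

theorem theorem4p2:
  fixes K L :: "nat set set" and n j m p q :: nat and s :: "nat \<Rightarrow> nat" and S :: "nat set"
    and \<alpha> \<beta> \<gamma> :: "nat \<Rightarrow> nat \<Rightarrow> real"
  assumes "abstract_simplicial_complex K" and "abstract_simplicial_complex L"
    and "vertices K \<inter> vertices L = {}"
    and "vertices (K \<union> L) = {1..n}"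
    and "admissible m \<alpha> (K \<union> L)" and "admissible p \<beta> K" and "admissible q \<gamma> L"
    and "j \<ge> 1" and "strict_mono_on {1..j + 1} s" and "S = s ` {1..j + 1}" and "S \<subseteq> {1..n}"
  shows "S \<in> algebraic_shifting m \<alpha> (K \<union> L) \<longleftrightarrow>
    s (j + 1) - s j \<le>
      card (one_extensions n (init (card S - 1) S) \<inter> algebraic_shifting p \<beta> K) +
      card (one_extensions n (init (card S - 1) S) \<inter> algebraic_shifting q \<gamma> L)"
proof -
  define A where "A = s ` {1..j}"
  have less: "s x < s y" if "1 \<le> x" "x < y" "y \<le> j + 1" for x y
    using that by (intro strict_mono_onD[OF assms(9)]) auto
  have S: "S = insert (s (j + 1)) A"
    unfolding assms(10) A_def using atLeastAtMostSuc_conv[of 1 j] by simp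
  have finA: "finite A" by (simp add: A_def)
  have above: "w < s (j + 1)" if "w \<in> A" for w
    using that less by (auto simp: A_def)
  have "inj_on s {1..j}"
    by (rule inj_onI) (metis atLeastAtMost_iff le_add1 le_trans less less_irrefl linorder_neqE_nat)
  then have cardA: "card A = j" by (simp add: A_def card_image)
  have "s (j + 1) \<notin> A" using above by blast
  then have cardS: "card S = j + 1" using finA cardA by (simp add: S)
  have sorted: "sorted_list_of_set (insert (s (j + 1)) A) = sorted_list_of_set A @ [s (j + 1)]"
    using finA above by (rule sorted_list_of_set_insert_last)
  have init: "init (card S - 1) S = A"
    unfolding init_def cardS unfolding S sorted using cardA finA by simp
  have MaxA: "Max A = s j"
  proof (rule Max_eqI[OF finA])
    show "s j \<in> A" using assms(8) by (simp add: A_def)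
    show "w \<le> s j" if "w \<in> A" for w
      using that less[of _ j] by (auto simp: A_def) (metis le_neq_implies_less le_add1 less_imp_le order_refl)
  qed
  \<comment> \<open>The assumption \<open>j \<ge> 1\<close> enters here: it makes \<open>A\<close>
    nonempty, so that \<open>Max A\<close> is its largest element \<open>s j\<close>.\<close>
  have An: "A \<subseteq> {1..n}" "A \<noteq> {}"
    using assms(8,11) S by (auto simp: A_def)
  have KL: "abstract_simplicial_complex (K \<union> L)"
    using assms(1,2) by (rule abstract_simplicial_complex_Un)
  have Vn: "vertices K \<subseteq> {1..n}" "vertices L \<subseteq> {1..n}"
    using assms(4) by (auto simp: vertices_Un)
  have nm: "{1..n} \<subseteq> {1..m}" and gen: "generic_matrix m \<alpha>"
    using assms(4,5) by (simp_all add: admissible_def)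
  \<comment> \<open>The matrix of the union is admissible for each part, so one matrix serves all
    three complexes.\<close>
  then have admK: "admissible m \<alpha> K" and admL: "admissible m \<alpha> L"
    using Vn by (auto simp: admissible_def)
  have "s (j + 1) \<in> {1..n}" using assms(11) by (simp add: S)
  then have "n \<le> m" "s (j + 1) \<le> m" using nm by auto
  have Am: "A \<subseteq> {1..m}" using An(1) nm by blast
  have "S \<in> algebraic_shifting m \<alpha> (K \<union> L) \<longleftrightarrow> s (j + 1) - Max A \<le> card (shifted_tops m A \<alpha> (K \<union> L))"
    unfolding S using MaxA less[of j "j + 1"] assms(8) \<open>s (j + 1) \<le> m\<close>
    by (intro mem_shifted_tops_iff[OF Am An(2) KL assms(5)]) auto
  also have "card (shifted_tops m A \<alpha> (K \<union> L)) = card (shifted_tops m A \<alpha> K) + card (shifted_tops m A \<alpha> L)"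
    using Am An(2) assms(1-3) gen by (rule card_shifted_tops_disjoint_Un)
  \<comment> \<open>Here \<open>\<beta>\<close> and \<open>\<gamma>\<close> are replaced by
    \<open>\<alpha>\<close>, and the extensions in \<open>{1..n}\<close> by tops up to
    \<open>m\<close>.\<close>
  finally show ?thesis
    unfolding init MaxA
      algebraic_shifting_unique[OF assms(1) assms(6) admK] algebraic_shifting_unique[OF assms(2) assms(7) admL]
      card_one_extensions_shifting[OF assms(1) admK An \<open>n \<le> m\<close> Vn(1)]
      card_one_extensions_shifting[OF assms(2) admL An \<open>n \<le> m\<close> Vn(2)] .
qed

end
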